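(* Let $d$ be a positive integer and let $\Delta$ be a pure color-shifted complex of dimension $d$ on $V=V_1\cup\cdots\cup V_{d+1}$, where $V_q=\{v_{q,1},\dots,v_{q,n_q}\}$. Let $\sigma=\{v_{1,\ell_1},\dots,v_{d+1,\ell_{d+1}}\}$ be a facet of $\Delta$ that is maximal among the facets of $\Delta$ in componentwise order, and such that $\ell_q\geq 2$ for all $q\in\{1,\dots,d+1\}$. Then $$\frac{\hat{k}_d(\Delta)}{\hat{k}_d(\Delta\setminus\sigma)}=\prod_{q=1}^{d+1}\frac{D_{q,\ell_q}}{D_{q,\ell_q-1}},$$ where $D_{q,j}=\sum_{i=1}^{j}x_{q,i}$.
   Context: Color-shifted complexes: Fix a positive integer $d$. For each color $q\in\{1,\dots,d+1\}$ let $V_q=\{v_{q,j} : j=1,\dots,n_q\}$ be a set of vertices of color $q$ (the sets $V_q$ are pairwise disjoint). A color-shifted complex on $V=V_1\cup\cdots\cup V_{d+1}$ is an abstract simplicial complex $\Delta$ on $V$ such that (1) each facet $\sigma$ of $\Delta$ has exactly one vertex of each color, i.e. $|\sigma\cap V_q|=1$ for each $q$ (so $\Delta$ is pure of dimension $d$); and (2) if $\sigma\in\Delta$ and $v_{q,j}\in\sigma$, then $(\sigma\setminus\{v_{q,j}\})\cup\{v_{q,j'}\}\in\Delta$ for every $j'<j$. Componentwise order on $d$-faces: $\{v_{1,j_1},\dots,v_{d+1,j_{d+1}}\}\leq\{v_{1,j'_1},\dots,v_{d+1,j'_{d+1}}\}$ if and only if $j_q\leq j'_q$ for every $q$. $\Delta\setminus\sigma$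 denotes the complex obtained from $\Delta$ by removing only the facet $\sigma$ (all proper subsets of $\sigma$ remain). Weights: each vertex $v_{q,j}$ has an indeterminate weight $x_{q,j}$, and a $d$-face $\tau=\{v_{1,j_1},\dots,v_{d+1,j_{d+1}}\}$ has weight $x_\tau=x_{1,j_1}\cdots x_{d+1,j_{d+1}}$. Spanning trees and weighted tree-number: For a $d$-dimensional simplicial complex $\Sigma$, let $\Sigma_d$ be its set of $d$-dimensional faces, $\Sigma^{(d-1)}$ its $(d-1)$-skeleton, and $b_i(\Sigma)=\operatorname{rank}\tilde H_i(\Sigma;\mathbb{Z})$ (reduced homology). A $d$-dimensional spanning tree of $\Sigma$ is a $d$-dimensional subcomplex $\Upsilon\subseteq\Sigma$ with $\Upsilon^{(d-1)}=\Sigma^{(d-1)}$, $b_{d-1}(\Upsilon)=b_{d-1}(\Sigma)$ and $b_d(\Upsilon)=0$; $\mathcal{T}_d(\Sigma)$ is the set of these. Let $\mathbf{t}_{d-1}(\Upsilon)$ be the order of the torsion subgroup of $\tilde H_{d-1}(\Upsilon;\mathbb{Z})$. The weighted tree-number is $$\hat k_d(\Sigma)=\sum_{\Upsilon\in\mathcal{T}_d(\Sigma)}\Big(\prod_{\tau\in\Upsilon_d}x_\tau\Big)\,\mathbf{t}_{d-1}(\Upsilon)^2.$$ *)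

theory Defs
  imports
    "HOL-Algebra.Algebra"
    "HOL-Computational_Algebra.Polynomial_Factorial"
begin

section \<open>Rank and torsion of abelian groups\<close>

definition Z_independent :: "('a, 'm) monoid_scheme \<Rightarrow> 'a set \<Rightarrow> bool" where
  "Z_independent G B \<longleftrightarrow>
     finite B \<and> B \<subseteq> carrier G \<and>
     (\<forall>c :: 'a \<Rightarrow> int. finprod G (\<lambda>x. x [^]\<^bsub>G\<^esub> c x) B = \<one>\<^bsub>G\<^esub> \<longrightarrow> (\<forall>x\<in>B. c x = 0))"

text \<open>Meaningful for abelian groups of finite rank; all groups below are finitely generated.\<close>

definition Z_rank :: "('a, 'm) monoid_scheme \<Rightarrow> nat" where
  "Z_rank G = Max (card ` {B. Z_independent G B})"

definition torsion_subgroup :: "('a, 'm) monoid_scheme \<Rightarrow> 'a set" where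
  "torsion_subgroup G = {x \<in> carrier G. \<exists>k::nat. k > 0 \<and> x [^]\<^bsub>G\<^esub> k = \<one>\<^bsub>G\<^esub>}"


section \<open>Abstract simplicial complexes\<close>

text \<open>The empty face belongs to every complex, and has dimension \<open>-1\<close>. Not every element
  of the ground set has to be a vertex of the complex.\<close>

definition simplicial_complex_on :: "'v set \<Rightarrow> 'v set set \<Rightarrow> bool" where
  "simplicial_complex_on V K \<longleftrightarrow>
     finite V \<and> K \<subseteq> Pow V \<and> K \<noteq> {} \<and> (\<forall>\<sigma>\<in>K. \<forall>\<tau>. \<tau> \<subseteq> \<sigma> \<longrightarrow> \<tau> \<in> K)"

definition face_dim :: "'v set \<Rightarrow> int" where
  "face_dim \<sigma> = int (card \<sigma>) - 1"

definition faces :: "'v set set \<Rightarrow> int \<Rightarrow> 'v set set" where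
  "faces K i = {\<sigma> \<in> K. face_dim \<sigma> = i}"

definition complex_dim :: "'v set set \<Rightarrow> int" where
  "complex_dim K = Max (face_dim ` K)"

definition skeleton :: "'v set set \<Rightarrow> int \<Rightarrow> 'v set set" where
  "skeleton K i = {\<sigma> \<in> K. face_dim \<sigma> \<le> i}"

definition facets :: "'v set set \<Rightarrow> 'v set set" where
  "facets K = {\<sigma> \<in> K. \<forall>\<tau>\<in>K. \<sigma> \<subseteq> \<tau> \<longrightarrow> \<tau> = \<sigma>}"


section \<open>Reduced simplicial homology with integer coefficients\<close>

definition chain_grp :: "'v set set \<Rightarrow> int \<Rightarrow> ('v set \<Rightarrow>\<^sub>0 int) monoid" where
  "chain_grp K i = free_Abelian_group (faces K i)"

text \<open>Every face is oriented by the linear order on the vertices, so the vertex in position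
  \<open>k\<close> (counting from \<open>0\<close>) is deleted with sign \<open>(-1)^k\<close>. The boundary of a single vertex is
  the empty face, i.e. the chain complex is the augmented one.\<close>

definition face_boundary :: "'v::linorder set \<Rightarrow> 'v set \<Rightarrow>\<^sub>0 int" where
  "face_boundary \<sigma> =
     (\<Sum>v\<in>\<sigma>. frag_cmul ((-1) ^ card {w \<in> \<sigma>. w < v}) (frag_of (\<sigma> - {v})))"

definition boundary_map :: "('v::linorder set \<Rightarrow>\<^sub>0 int) \<Rightarrow> ('v set \<Rightarrow>\<^sub>0 int)" where
  "boundary_map = frag_extend face_boundary"

definition cycles :: "'v::linorder set set \<Rightarrow> int \<Rightarrow> ('v set \<Rightarrow>\<^sub>0 int) set" where
  "cycles K i = {c \<in> carrier (chain_grp K i). boundary_map c = 0}"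

definition boundaries :: "'v::linorder set set \<Rightarrow> int \<Rightarrow> ('v set \<Rightarrow>\<^sub>0 int) set" where
  "boundaries K i = boundary_map ` carrier (chain_grp K (i + 1))"

definition reduced_homology ::
    "'v::linorder set set \<Rightarrow> int \<Rightarrow> ('v set \<Rightarrow>\<^sub>0 int) set monoid" where
  "reduced_homology K i = subgroup_generated (chain_grp K i) (cycles K i) Mod boundaries K i"

definition betti :: "'v::linorder set set \<Rightarrow> int \<Rightarrow> nat" where
  "betti K i = Z_rank (reduced_homology K i)"

definition torsion_number :: "'v::linorder set set \<Rightarrow> int \<Rightarrow> nat" where
  "torsion_number K i = card (torsion_subgroup (reduced_homology K i))"


section \<open>Spanning trees and weighted tree-numbers\<close>

definition spanning_trees :: "int \<Rightarrow> 'v::linorder set set \<Rightarrow> 'v set set set" where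
  "spanning_trees d K =
     {T. T \<subseteq> K \<and> simplicial_complex_on (\<Union>K) T \<and> complex_dim T = d \<and>
         skeleton T (d - 1) = skeleton K (d - 1) \<and>
         betti T (d - 1) = betti K (d - 1) \<and> betti T d = 0}"

text \<open>The integer polynomials in indeterminates indexed by \<open>'v\<close>: finitely supported
  functions from monomials (finitely supported exponent functions) to coefficients.\<close>

type_synonym 'v int_mpoly = "('v \<Rightarrow>\<^sub>0 nat) \<Rightarrow>\<^sub>0 int"

definition indet :: "'v \<Rightarrow> 'v int_mpoly" where
  "indet v = Poly_Mapping.single (Poly_Mapping.single v 1) 1"

definition face_weight :: "'v set \<Rightarrow> 'v int_mpoly" where
  "face_weight \<tau> = (\<Prod>v\<in>\<tau>. indet v)"

definition weighted_tree_number :: "int \<Rightarrow> 'v::linorder set set \<Rightarrow> 'v int_mpoly" where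
  "weighted_tree_number d K =
     (\<Sum>T\<in>spanning_trees d K.
        (\<Prod>\<tau>\<in>faces T d. face_weight \<tau>) * of_nat ((torsion_number T (d - 1))\<^sup>2))"


section \<open>Color-shifted complexes\<close>

text \<open>\<open>Vert q j\<close> is the vertex $v_{q,j}$; colors and indices are counted from \<open>1\<close>. The
  lexicographic order orients the faces (homology does not depend on this choice up to
  isomorphism) and makes the polynomial ring an instance of \<open>idom\<close>.\<close>

datatype vertex = Vert (color: nat) (idx: nat)

instantiation vertex :: linorder
begin

definition less_eq_vertex :: "vertex \<Rightarrow> vertex \<Rightarrow> bool" where
  "less_eq_vertex v w \<longleftrightarrow> color v < color w \<or> color v = color w \<and> idx v \<le> idx w"

definition less_vertex :: "vertex \<Rightarrow> vertex \<Rightarrow> bool" where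
  "less_vertex v w \<longleftrightarrow> color v < color w \<or> color v = color w \<and> idx v < idx w"

instance
  by standard (auto simp: less_eq_vertex_def less_vertex_def intro: vertex.expand)

end

definition color_class :: "(nat \<Rightarrow> nat) \<Rightarrow> nat \<Rightarrow> vertex set" where
  "color_class n q = {Vert q j | j. j \<in> {1..n q}}"

definition color_shifted :: "nat \<Rightarrow> (nat \<Rightarrow> nat) \<Rightarrow> vertex set set \<Rightarrow> bool" where
  "color_shifted d n K \<longleftrightarrow>
     simplicial_complex_on (\<Union>q\<in>{1..d + 1}. color_class n q) K \<and>
     (\<forall>\<sigma>\<in>facets K. \<forall>q\<in>{1..d + 1}. card (\<sigma> \<inter> color_class n q) = 1) \<and>
     (\<forall>\<sigma>\<in>K. \<forall>q j j'. Vert q j \<in> \<sigma> \<and> 1 \<le> j' \<and> j' < j \<longrightarrow>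
        (\<sigma> - {Vert q j}) \<union> {Vert q j'} \<in> K)"

definition rainbow_face :: "nat \<Rightarrow> (nat \<Rightarrow> nat) \<Rightarrow> vertex set" where
  "rainbow_face d j = {Vert q (j q) | q. q \<in> {1..d + 1}}"

definition componentwise_le :: "nat \<Rightarrow> vertex set \<Rightarrow> vertex set \<Rightarrow> bool" where
  "componentwise_le d \<sigma> \<tau> \<longleftrightarrow>
     (\<exists>j j'. \<sigma> = rainbow_face d j \<and> \<tau> = rainbow_face d j' \<and> (\<forall>q\<in>{1..d + 1}. j q \<le> j' q))"

text \<open>$D_{q,j} = x_{q,1} + \cdots + x_{q,j}$\<close>

definition D_sum :: "nat \<Rightarrow> nat \<Rightarrow> vertex int_mpoly" where
  "D_sum q j = (\<Sum>i = 1..j. indet (Vert q i))"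

end

theory Submission
  imports Defs "Jordan_Normal_Form.Determinant"
begin

text \<open>Write \<open>F\<close> for the set of top-dimensional faces of a color-shifted complex, each given by its vector of
indices, and \<open>F1\<close> for those faces all of whose indices are at least \<open>2\<close>. The theorem is a quotient
of two instances of a product formula (\<open>weighted_tree_number_formula\<close>) for the weighted tree-number,
\[ \prod_{\tau\in F} x_\tau \cdot \prod_{\tau\in F1} \prod_q \frac{D_{q,j_q}}{x_{q,j_q} D_{q,j_q-1}} , \]
where \<open>j\<close> is the index vector of \<open>\<tau>\<close>: removing the maximal facet \<open>\<sigma>\<close> leaves a color-shifted complex and
takes exactly one factor out of each of the two products.

The formula has a topological and an algebraic half. For \<open>\<tau>\<close> in \<open>F1\<close> the cross-polytope on the vertices
\<open>v(q,1)\<close>, \<open>v(q,j q)\<close> lies in the complex, and its fundamental cycle has coefficient \<open>1\<close> at \<open>\<tau>\<close> and \<open>0\<close> at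
the other members of \<open>F1\<close>. A top-dimensional chain is a cycle iff its coefficients sum to zero along
every line of faces that differ in one color only; therefore these cycles form a basis of all cycles
(\<open>line_sums_zero_iff\<close>). Coning off one color after another shows that homology in codimension one
vanishes (\<open>codim1_cycle_is_boundary\<close>). So if a set \<open>R\<close> of top faces is removed, then the
codimension-one homology of the remainder is the group of integer vectors on \<open>R\<close> modulo the rows of the
matrix of the cycle basis restricted to the columns in \<open>R\<close>. The remainder is a spanning tree iff
this matrix is square with nonzero determinant, and the order of the torsion is then the absolute
value of the determinant (\<open>torsion_number_eq_fdet\<close>).

The weighted tree-number thus equals the product of all face weights times a sum of squared maximal
minors, the one with columns \<open>R\<close> divided by the weight of \<open>R\<close>. By the Cauchy--Binet formula
the sum is the Gram determinant of the cycle basis for the weights \<open>1 / x\<close>. Entrywise this Gram matrix is a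
product over the colors of the matrices \<open>diag (1/x 2, 1/x 3, ...) + (1/x 1)\<close>, and each of these
is \<open>L P L\<^sup>T\<close> with \<open>L\<close> lower unitriangular and \<open>P\<close> diagonal with the entries
\<open>D_j / (x_j D_{j-1})\<close>. Because \<open>F1\<close> is closed under decreasing indices that stay at least \<open>2\<close>, the product of
these factorizations restricts to \<open>F1\<close>, and the determinant is the product of the pivots
(\<open>sum_cross_minors\<close>).\<close>

section \<open>Row lattices of integer matrices and the Cauchy--Binet formula\<close>

text \<open>Elimination of one coordinate at a time without division: this is the only dimension count needed for
bounding ranks, and it keeps all coefficients integral.\<close>

lemma integer_relation:
  fixes v :: "'j \<Rightarrow> 'i \<Rightarrow> int"
  assumes "finite I" "finite J" "card I < card J"
  shows "\<exists>c. (\<exists>j\<in>J. c j \<noteq> 0) \<and> (\<forall>i\<in>I. (\<Sum>j\<in>J. c j * v j i) = 0)"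
  using assms
proof (induction I arbitrary: J v rule: finite_induct)
  case empty
  then obtain j where "j \<in> J" by fastforce
  then show ?case by (intro exI[of _ "\<lambda>_. 1"]) auto
next
  case (insert i I)
  show ?case
  proof (cases "\<forall>j\<in>J. v j i = 0")
    case True
    have "card I < card J" using insert by auto
    from insert.IH[OF \<open>finite J\<close> this, of v] obtain c where
      c: "\<exists>j\<in>J. c j \<noteq> 0" "\<forall>i\<in>I. (\<Sum>j\<in>J. c j * v j i) = 0" by blast
    then show ?thesis using True by (intro exI[of _ c]) auto
  next
    case False
    then obtain k where k: "k \<in> J" "v k i \<noteq> 0" by blast
    \<comment> \<open>Pivoting on \<open>v k\<close> kills the coordinate \<open>i\<close>; cross-multiplication replaces division by \<open>v k i\<close>.\<close>
    define w where "w j e = v k i * v j e - v j i * v k e" for j e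
    have "finite (J - {k})" "card I < card (J - {k})"
      using insert k by (auto simp: card_Diff_singleton)
    from insert.IH[OF this, of w] obtain c where
      c: "\<exists>j\<in>J-{k}. c j \<noteq> 0" "\<forall>i\<in>I. (\<Sum>j\<in>J-{k}. c j * w j i) = 0" by blast
    define c' where "c' j = (if j = k then - (\<Sum>j\<in>J-{k}. c j * v j i) else v k i * c j)" for j
    have eq: "(\<Sum>j\<in>J. c' j * v j e) = (\<Sum>j\<in>J-{k}. c j * w j e)" for e
    proof -
      have "(\<Sum>j\<in>J. c' j * v j e) = c' k * v k e + (\<Sum>j\<in>J-{k}. c' j * v j e)"
        using insert k by (simp add: sum.remove)
      also have "(\<Sum>j\<in>J-{k}. c' j * v j e) = (\<Sum>j\<in>J-{k}. v k i * c j * v j e)"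
        by (intro sum.cong) (auto simp: c'_def)
      also have "c' k * v k e = (\<Sum>j\<in>J-{k}. - (c j * v j i * v k e))"
        by (simp add: c'_def sum_distrib_right sum_negf)
      finally show ?thesis
        by (simp add: w_def sum.distrib[symmetric] algebra_simps)
    qed
    have "(\<Sum>j\<in>J-{k}. c j * w j i) = 0" by (simp add: w_def)
    then show ?thesis using c k eq
      by (intro exI[of _ c']) (auto simp: c'_def)
  qed
qed

definition in_row_lattice :: "nat \<Rightarrow> (nat \<Rightarrow> nat \<Rightarrow> int) \<Rightarrow> (nat \<Rightarrow> int) \<Rightarrow> bool" where
  "in_row_lattice n M v \<longleftrightarrow> (\<exists>c. \<forall>j<n. v j = (\<Sum>i<n. c i * M i j))"

definition fdet :: "nat \<Rightarrow> (nat \<Rightarrow> nat \<Rightarrow> 'a::comm_ring_1) \<Rightarrow> 'a" where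
  "fdet n M = det (mat n n (\<lambda>(i,j). M i j))"

text \<open>Adding a multiple of one row to another changes neither the row lattice nor the determinant. These are
the only row operations used to compare the index of the lattice with the determinant.\<close>

definition add_row :: "int \<Rightarrow> nat \<Rightarrow> nat \<Rightarrow> (nat \<Rightarrow> nat \<Rightarrow> int) \<Rightarrow> nat \<Rightarrow> nat \<Rightarrow> int" where
  "add_row s i k M = M(k := \<lambda>j. M k j + s * M i j)"

lemma in_row_lattice_add_row_imp:
  assumes "i < n" "k < n" "i \<noteq> k" "in_row_lattice n (add_row s i k M) v"
  shows "in_row_lattice n M v"
proof -
  from assms obtain c where c: "\<forall>j<n. v j = (\<Sum>r<n. c r * add_row s i k M r j)"
    by (auto simp: in_row_lattice_def)
  have "(\<Sum>r<n. c r * add_row s i k M r j) = (\<Sum>r<n. (c(i := c i + s * c k)) r * M r j)" for j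
  proof -
    have "(\<Sum>r<n. c r * add_row s i k M r j) =
        (\<Sum>r<n. c r * M r j + (if r = k then c k * s * M i j else 0))"
      by (intro sum.cong) (auto simp: add_row_def algebra_simps)
    also have "\<dots> = (\<Sum>r<n. c r * M r j) + c k * s * M i j"
      using assms by (simp add: sum.distrib sum.delta)
    also have "\<dots> = (\<Sum>r<n. c r * M r j + (if r = i then c k * s * M i j else 0))"
      using assms by (simp add: sum.distrib sum.delta)
    also have "\<dots> = (\<Sum>r<n. (c(i := c i + s * c k)) r * M r j)"
      by (intro sum.cong) (auto simp: algebra_simps)
    finally show ?thesis .
  qed
  with c show ?thesis unfolding in_row_lattice_def by metis
qed

lemma in_row_lattice_add_row:
  assumes "i < n" "k < n" "i \<noteq> k"
  shows "in_row_lattice n (add_row s i k M) v \<longleftrightarrow> in_row_lattice n M v"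
proof
  assume "in_row_lattice n M v"
  moreover have "M = add_row (-s) i k (add_row s i k M)"
    using assms by (auto simp: add_row_def fun_eq_iff)
  ultimately show "in_row_lattice n (add_row s i k M) v"
    using in_row_lattice_add_row_imp[OF assms] by metis
qed (rule in_row_lattice_add_row_imp[OF assms])

lemma fdet_add_row:
  assumes "i < n" "k < n" "i \<noteq> k"
  shows "fdet n (add_row s i k M) = fdet n M"
proof -
  have "mat n n (\<lambda>(r,j). add_row s i k M r j) = addrow s k i (mat n n (\<lambda>(r,j). M r j))"
    using assms by (intro eq_matI) (auto simp: add_row_def)
  then show ?thesis unfolding fdet_def using assms
    by (metis det_addrow mat_carrier)
qed

text \<open>A transversal of the cosets of the row lattice in the group of integer vectors of length \<open>n\<close>. Vectors are
functions on all naturals, of which only the values below \<open>n\<close> matter; stating the index of the lattice through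
a transversal makes it easy to carry over to an abstract quotient group.\<close>

definition row_transversal :: "nat \<Rightarrow> (nat \<Rightarrow> nat \<Rightarrow> int) \<Rightarrow> (nat \<Rightarrow> int) set \<Rightarrow> bool" where
  "row_transversal n M Z \<longleftrightarrow> (\<forall>v. \<exists>!x. x \<in> Z \<and> in_row_lattice n M (\<lambda>j. v j - x j))"

lemma fdet_last_column:
  assumes "\<And>i. i < n \<Longrightarrow> M i n = 0"
  shows "fdet (Suc n) M = M n n * fdet n M"
proof -
  let ?A = "mat (Suc n) (Suc n) (\<lambda>(i,j). M i j)"
  have "det ?A = (\<Sum>i<Suc n. ?A $$ (i,n) * cofactor ?A i n)"
    by (rule laplace_expansion_column) auto
  also have "\<dots> = M n n * cofactor ?A n n" using assms by simp
  also have "mat_delete ?A n n = mat n n (\<lambda>(i,j). M i j)"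
    by (intro eq_matI) (auto simp: mat_delete_def)
  then have "cofactor ?A n n = fdet n M"
    by (simp add: cofactor_def fdet_def flip: mult_2)
  finally show ?thesis by (simp add: fdet_def)
qed

text \<open>If the last column has a single nonzero entry, in the last row, then membership in the lattice fixes the
coefficient of the last row through the last coordinate. The last coordinate therefore contributes its
residue modulo the pivot, and the remaining coordinates a coset of the lattice of the smaller matrix.\<close>

lemma row_transversal_step:
  assumes "\<And>i. i < n \<Longrightarrow> M i n = 0" and g: "M n n \<noteq> 0"
    and Z: "finite Z" "row_transversal n M Z"
  shows "\<exists>Y. finite Y \<and> card Y = nat \<bar>M n n\<bar> * card Z \<and> row_transversal (Suc n) M Y"
proof -
  define g where "g = M n n"
  define h where "h = (\<lambda>(a::int, x::nat \<Rightarrow> int). x(n := a))"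
  let ?Z = "{0..<\<bar>g\<bar>} \<times> Z"
  have lat: "in_row_lattice (Suc n) M w \<longleftrightarrow>
      (\<exists>t. w n = t * g \<and> in_row_lattice n M (\<lambda>j. w j - t * M n j))" for w
  proof
    assume "in_row_lattice (Suc n) M w"
    then obtain c where c: "\<forall>j<Suc n. w j = (\<Sum>i<Suc n. c i * M i j)"
      by (auto simp: in_row_lattice_def)
    then have "w n = c n * g" using assms(1) by (simp add: g_def)
    moreover have "in_row_lattice n M (\<lambda>j. w j - c n * M n j)"
      using c unfolding in_row_lattice_def by (intro exI[of _ c]) auto
    ultimately show "\<exists>t. w n = t * g \<and> in_row_lattice n M (\<lambda>j. w j - t * M n j)" by blast
  next
    assume "\<exists>t. w n = t * g \<and> in_row_lattice n M (\<lambda>j. w j - t * M n j)"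
    then obtain t c where t: "w n = t * g"
      and c: "\<forall>j<n. w j - t * M n j = (\<Sum>i<n. c i * M i j)" unfolding in_row_lattice_def by blast
    have c': "w j = (\<Sum>i<n. c i * M i j) + t * M n j" if "j < n" for j
      using c that by (metis diff_eq_eq)
    have "\<forall>j<Suc n. w j = (\<Sum>i<Suc n. (c(n:=t)) i * M i j)"
      using t c' assms(1) by (auto simp: less_Suc_eq g_def)
    then show "in_row_lattice (Suc n) M w" unfolding in_row_lattice_def by blast
  qed
  have cong: "in_row_lattice n M w = in_row_lattice n M w'" if "\<And>j. j < n \<Longrightarrow> w j = w' j" for w w'
    using that by (simp add: in_row_lattice_def)
  have ex1: "\<exists>!ax. ax \<in> ?Z \<and> in_row_lattice (Suc n) M (\<lambda>j. v j - h ax j)" for v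
  proof -
    define t where "t = (v n - v n mod \<bar>g\<bar>) div g"
    have "g dvd v n - v n mod \<bar>g\<bar>"
      by (metis abs_dvd_iff dvd_minus_mod)
    then have tg: "v n - v n mod \<bar>g\<bar> = t * g" by (simp add: t_def)
    from Z(2) obtain x where x: "x \<in> Z" "in_row_lattice n M (\<lambda>j. (v j - t * M n j) - x j)"
      and xu: "\<And>x'. x' \<in> Z \<Longrightarrow> in_row_lattice n M (\<lambda>j. (v j - t * M n j) - x' j) \<Longrightarrow> x' = x"
      unfolding row_transversal_def by meson
    have rng: "v n mod \<bar>g\<bar> \<in> {0..<\<bar>g\<bar>}" using g by (auto simp: g_def)
    show ?thesis
    proof (rule ex1I[of _ "(v n mod \<bar>g\<bar>, x)"], intro conjI)
      show "(v n mod \<bar>g\<bar>, x) \<in> ?Z" using rng x by simp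
      show "in_row_lattice (Suc n) M (\<lambda>j. v j - h (v n mod \<bar>g\<bar>, x) j)"
        unfolding lat
        by (rule exI[of _ t], intro conjI)
           (auto simp: h_def tg algebra_simps intro: iffD1[OF cong x(2)])
    next
      fix ax assume ax: "ax \<in> ?Z \<and> in_row_lattice (Suc n) M (\<lambda>j. v j - h ax j)"
      obtain a x' where [simp]: "ax = (a, x')" by force
      from ax obtain s where s: "v n - a = s * g"
          "in_row_lattice n M (\<lambda>j. v j - (x'(n:=a)) j - s * M n j)"
        unfolding lat by (auto simp: h_def)
      have "v n = a + \<bar>g\<bar> * (sgn g * s)" using s(1)
        by (metis (no_types, lifting) abs_sgn add.commute diff_eq_eq mult.assoc mult.commute
            sgn_mult_abs mult_sgn_abs)
      then have "a = v n mod \<bar>g\<bar>" using ax by simp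
      with s(1) tg have "s = t" using g by (simp add: g_def)
      have "in_row_lattice n M (\<lambda>j. (v j - t * M n j) - x' j)"
        using s(2) by (rule iffD1[OF cong, rotated]) (simp add: \<open>s = t\<close>)
      with xu ax have "x' = x" by auto
      then show "ax = (v n mod \<bar>g\<bar>, x)" using \<open>a = _\<close> by simp
    qed
  qed
  have inj: "inj_on h ?Z"
  proof (rule inj_onI)
    fix p q assume pq: "p \<in> ?Z" "q \<in> ?Z" "h p = h q"
    have "in_row_lattice (Suc n) M (\<lambda>j. h p j - h p j)"
      unfolding in_row_lattice_def by (intro exI[of _ "\<lambda>_. 0"]) simp
    with ex1[of "h p"] pq show "p = q" by metis
  qed
  show ?thesis
  proof (intro exI[of _ "h ` ?Z"] conjI)
    show "finite (h ` ?Z)" using Z by simp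
    show "card (h ` ?Z) = nat \<bar>M n n\<bar> * card Z"
      unfolding card_image[OF inj] by (simp add: card_cartesian_product g_def)
    show "row_transversal (Suc n) M (h ` ?Z)"
      unfolding row_transversal_def
    proof
      fix v
      from ex1[of v] obtain p where p: "p \<in> ?Z" "in_row_lattice (Suc n) M (\<lambda>j. v j - h p j)"
        "\<And>q. q \<in> ?Z \<Longrightarrow> in_row_lattice (Suc n) M (\<lambda>j. v j - h q j) \<Longrightarrow> q = p" by metis
      then show "\<exists>!x. x \<in> h ` ?Z \<and> in_row_lattice (Suc n) M (\<lambda>j. v j - x j)"
        by (intro ex1I[of _ "h p"]) blast+
    qed
  qed
qed

text \<open>The index of the row lattice of a nonsingular square integer matrix is the absolute value of the
determinant. Euclid's algorithm on the last column, run by adding and subtracting rows, reduces the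
sum of the absolute values in that column until a single entry is left.\<close>

lemma row_lattice_transversal:
  assumes "fdet n M \<noteq> 0"
  shows "\<exists>Z. finite Z \<and> card Z = nat \<bar>fdet n M\<bar> \<and> row_transversal n M Z"
  using assms
proof (induction n arbitrary: M)
  case 0
  have "row_transversal 0 M {\<lambda>_. 0}" by (auto simp: row_transversal_def in_row_lattice_def)
  moreover have "fdet 0 M = 1" by (simp add: fdet_def)
  ultimately show ?case by (intro exI[of _ "{\<lambda>_. 0}"]) auto
next
  case (Suc n)
  have base: "\<exists>Z. finite Z \<and> card Z = nat \<bar>fdet (Suc n) M\<bar> \<and> row_transversal (Suc n) M Z"
    if "fdet (Suc n) M \<noteq> 0" "\<And>i. i < n \<Longrightarrow> M i n = 0" for M
  proof -
    have d: "fdet (Suc n) M = M n n * fdet n M" using that(2) by (rule fdet_last_column)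
    with that have "fdet n M \<noteq> 0" "M n n \<noteq> 0" by auto
    with Suc.IH[of M] obtain Z where "finite Z" "card Z = nat \<bar>fdet n M\<bar>" "row_transversal n M Z"
      by blast
    with row_transversal_step[of n M Z, OF that(2) \<open>M n n \<noteq> 0\<close>] show ?thesis
      by (simp add: d abs_mult nat_mult_distrib)
  qed
  have op: "(\<exists>Z. finite Z \<and> card Z = nat \<bar>fdet (Suc n) M\<bar> \<and> row_transversal (Suc n) M Z)"
    if "i < Suc n" "k < Suc n" "i \<noteq> k" "\<exists>Z. finite Z \<and> card Z = nat \<bar>fdet (Suc n) (add_row s i k M)\<bar> \<and>
       row_transversal (Suc n) (add_row s i k M) Z" for i k s M
    using that by (simp add: fdet_add_row row_transversal_def in_row_lattice_add_row)
  show ?case using Suc.prems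
  proof (induction "\<Sum>i<Suc n. nat \<bar>M i n\<bar>" arbitrary: M rule: less_induct)
    case (less M)
    show ?case
    proof (cases "\<exists>i k. i < Suc n \<and> k < Suc n \<and> i \<noteq> k \<and> M i n \<noteq> 0 \<and> M k n \<noteq> 0")
      case True
      then obtain i k where ik: "i < Suc n" "k < Suc n" "i \<noteq> k" "M i n \<noteq> 0" "M k n \<noteq> 0"
        "\<bar>M i n\<bar> \<le> \<bar>M k n\<bar>" by (metis linorder_le_cases)
      define s where "s = - (sgn (M i n) * sgn (M k n))"
      have small: "\<bar>add_row s i k M k n\<bar> < \<bar>M k n\<bar>"
        using ik by (auto simp: add_row_def s_def sgn_if split: if_splits)
      have dec: "(\<Sum>r<Suc n. nat \<bar>add_row s i k M r n\<bar>) < (\<Sum>r<Suc n. nat \<bar>M r n\<bar>)"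
      proof (rule sum_strict_mono_ex1)
        show "\<forall>r\<in>{..<Suc n}. nat \<bar>add_row s i k M r n\<bar> \<le> nat \<bar>M r n\<bar>"
        proof
          fix r show "nat \<bar>add_row s i k M r n\<bar> \<le> nat \<bar>M r n\<bar>"
            using small by (cases "r = k") (auto simp: add_row_def)
        qed
        show "\<exists>r\<in>{..<Suc n}. nat \<bar>add_row s i k M r n\<bar> < nat \<bar>M r n\<bar>"
          using small ik by (intro bexI[of _ k]) auto
      qed simp
      have "fdet (Suc n) (add_row s i k M) \<noteq> 0"
        using less.prems ik by (simp add: fdet_add_row)
      from op[OF ik(1-3), of s, OF less.hyps[of "add_row s i k M", OF dec this]] show ?thesis .
    next
      case False
      show ?thesis
      proof (cases "\<exists>i<n. M i n \<noteq> 0")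
        case True
        then obtain i where i: "i < n" "M i n \<noteq> 0" by blast
        with False have z: "M k n = 0" if "k < Suc n" "k \<noteq> i" for k using that
          by (metis less_SucI)
        \<comment> \<open>Two row additions move the only nonzero entry of the column into the last row.\<close>
        let ?M1 = "add_row 1 i n M"
        let ?M2 = "add_row (-1) n i ?M1"
        have "?M2 r n = 0" if "r < n" for r
          using that i z[of r] z[of n] by (cases "r = i") (auto simp: add_row_def)
        moreover have "fdet (Suc n) ?M2 \<noteq> 0"
          using less.prems i by (simp add: fdet_add_row)
        ultimately have "\<exists>Z. finite Z \<and> card Z = nat \<bar>fdet (Suc n) ?M2\<bar> \<and> row_transversal (Suc n) ?M2 Z"
          using base[of ?M2] by blast
        from op[of i n 1 M, OF _ _ _ op[of n i "-1" ?M1, OF _ _ _ this]] show ?thesis using i by simp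
      next
        case False
        then show ?thesis using base less.prems by blast
      qed
    qed
  qed
qed

text \<open>The Cauchy--Binet formula for \<open>A Y A\<^sup>T\<close> with \<open>Y\<close> diagonal. The columns of \<open>A\<close> are indexed by
an arbitrary finite set, and \<open>g\<close> fixes an enumeration of each choice of \<open>n\<close> columns; its choice is irrelevant
because the minors are squared. The Leibniz expansion turns the left side into a sum over maps from row
indices to columns; maps that are not injective give two equal rows, and the others are grouped by their image.\<close>

lemma fdet_cauchy_binet_gram:
  fixes a :: "nat \<Rightarrow> 'r \<Rightarrow> 'a::comm_ring_1"
  assumes "finite F" and g: "\<And>R. R \<subseteq> F \<Longrightarrow> card R = n \<Longrightarrow> bij_betw (g R) {0..<n} R"
  shows "fdet n (\<lambda>i k. \<Sum>r\<in>F. a i r * y r * a k r) =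
         (\<Sum>R | R \<subseteq> F \<and> card R = n. (\<Prod>r\<in>R. y r) * (fdet n (\<lambda>i k. a i (g R k)))\<^sup>2)"
proof -
  let ?U = "{0..<n}"
  let ?P = "{p. p permutes ?U}"
  have fdef: "fdet n M = (\<Sum>p\<in>?P. signof p * (\<Prod>i\<in>?U. M i (p i)))" for M :: "nat \<Rightarrow> nat \<Rightarrow> 'a"
    unfolding fdet_def det_def'[OF mat_carrier]
    by (intro sum.cong refl arg_cong2[where f="(*)"] prod.cong) (auto dest: permutes_in_image)
  have ftr: "fdet n M = fdet n (\<lambda>i k. M k i)" for M :: "nat \<Rightarrow> nat \<Rightarrow> 'a"
  proof -
    have "mat n n (\<lambda>(i,j). M j i) = transpose_mat (mat n n (\<lambda>(i,j). M i j))"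
      by (intro eq_matI) auto
    then show ?thesis unfolding fdet_def by (simp add: det_transpose[of _ n])
  qed
  define w where "w f = (\<Prod>i\<in>?U. a i (f i) * y (f i)) * fdet n (\<lambda>i k. a k (f i))" for f
  have "fdet n (\<lambda>i k. \<Sum>r\<in>F. a i r * y r * a k r) =
      (\<Sum>p\<in>?P. signof p * (\<Sum>f\<in>PiE ?U (\<lambda>_. F). \<Prod>i\<in>?U. a i (f i) * y (f i) * a (p i) (f i)))"
    unfolding fdef using assms(1) by (subst prod_sum_PiE) auto
  also have "\<dots> = (\<Sum>f\<in>PiE ?U (\<lambda>_. F). w f)"
    unfolding w_def fdef
    by (simp add: sum_distrib_left prod.distrib) (subst sum.swap, simp add: mult_ac)
  also have "\<dots> = (\<Sum>f\<in>{f\<in>PiE ?U (\<lambda>_. F). inj_on f ?U}. w f)"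
  proof (rule sum.mono_neutral_right)
    show "finite (PiE ?U (\<lambda>_. F))" using assms(1) by (simp add: finite_PiE)
    show "\<forall>f\<in>PiE ?U (\<lambda>_. F) - {f\<in>PiE ?U (\<lambda>_. F). inj_on f ?U}. w f = 0"
    proof
      fix f assume "f \<in> PiE ?U (\<lambda>_. F) - {f\<in>PiE ?U (\<lambda>_. F). inj_on f ?U}"
      then obtain i j where ij: "i < n" "j < n" "i \<noteq> j" "f i = f j" by (auto simp: inj_on_def)
      have "det (mat n n (\<lambda>(i,k). a k (f i))) = 0"
        using ij by (intro det_identical_rows[of _ n i j]) auto
      then show "w f = 0" by (simp add: w_def fdet_def)
    qed
  qed auto
  also have "\<dots> = (\<Sum>R | R \<subseteq> F \<and> card R = n. \<Sum>f\<in>{f\<in>PiE ?U (\<lambda>_. F). inj_on f ?U \<and> f ` ?U = R}. w f)"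
  proof -
    have "(\<Sum>R | R \<subseteq> F \<and> card R = n. \<Sum>f\<in>{f\<in>{f\<in>PiE ?U (\<lambda>_. F). inj_on f ?U}. f ` ?U = R}. w f) =
        (\<Sum>f\<in>{f\<in>PiE ?U (\<lambda>_. F). inj_on f ?U}. w f)"
    proof (rule sum.group)
      show "finite {f\<in>PiE ?U (\<lambda>_. F). inj_on f ?U}" using assms(1) by (simp add: finite_PiE)
      show "finite {R. R \<subseteq> F \<and> card R = n}" using assms(1) by simp
      show "(\<lambda>f. f ` ?U) ` {f\<in>PiE ?U (\<lambda>_. F). inj_on f ?U} \<subseteq> {R. R \<subseteq> F \<and> card R = n}"
        by (auto simp: card_image)
    qed
    then show ?thesis by (simp add: conj_assoc)
  qed
  also have "\<dots> = (\<Sum>R | R \<subseteq> F \<and> card R = n. (\<Prod>r\<in>R. y r) * (fdet n (\<lambda>i k. a i (g R k)))\<^sup>2)"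
  proof (rule sum.cong[OF refl])
    fix R assume "R \<in> {R. R \<subseteq> F \<and> card R = n}"
    then have R: "R \<subseteq> F" "card R = n" by auto
    note gR = g[OF R]
    define G where "G = g R"
    have G: "bij_betw G ?U R" using gR by (simp add: G_def)
    let ?D = "fdet n (\<lambda>i k. a i (G k))"
    have val: "w (restrict (G \<circ> p) ?U) = (\<Prod>r\<in>R. y r) * ?D * (signof p * (\<Prod>i\<in>?U. a i (G (p i))))"
      if p: "p permutes ?U" for p
    proof -
      have "w (restrict (G \<circ> p) ?U) = (\<Prod>i\<in>?U. a i (G (p i))) * (\<Prod>i\<in>?U. y (G (p i)))
          * fdet n (\<lambda>i k. a k (restrict (G \<circ> p) ?U i))"
        unfolding w_def by (simp add: prod.distrib cong: prod.cong_simp)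
      also have "(\<Prod>i\<in>?U. y (G (p i))) = (\<Prod>i\<in>?U. y (G i))"
        using prod.permute[OF p, of "\<lambda>i. y (G i)"] by (simp add: o_def)
      also have "\<dots> = (\<Prod>r\<in>R. y r)"
        using G by (rule prod.reindex_bij_betw)
      also have "fdet n (\<lambda>i k. a k (restrict (G \<circ> p) ?U i)) = signof p * fdet n (\<lambda>i k. a k (G i))"
      proof -
        let ?A = "mat n n (\<lambda>(i,k). a k (G i))"
        have pn: "p i < n" if "i < n" for i using p that by (metis atLeastLessThan_iff permutes_in_image zero_le)
        have "mat n n (\<lambda>(i,k). a k (restrict (G \<circ> p) ?U i)) = mat n n (\<lambda>(i,k). ?A $$ (p i, k))"
          using pn by (intro eq_matI) auto
        then show ?thesis unfolding fdet_def using det_permute_rows[OF mat_carrier p] by metis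
      qed
      also have "fdet n (\<lambda>i k. a k (G i)) = ?D" by (rule ftr)
      finally show ?thesis by (simp only: mult_ac)
    qed
    have "(\<Sum>f\<in>{f\<in>PiE ?U (\<lambda>_. F). inj_on f ?U \<and> f ` ?U = R}. w f) =
        (\<Sum>p\<in>?P. w (restrict (G \<circ> p) ?U))"
    proof (rule sum.reindex_bij_betw[symmetric], rule bij_betwI')
      fix p q assume pq: "p \<in> ?P" "q \<in> ?P"
      show "(restrict (G \<circ> p) ?U = restrict (G \<circ> q) ?U) = (p = q)"
      proof
        assume eq: "restrict (G \<circ> p) ?U = restrict (G \<circ> q) ?U"
        show "p = q"
        proof
          fix i show "p i = q i"
          proof (cases "i \<in> ?U")
            case True
            then have "G (p i) = G (q i)" using eq by (metis comp_apply restrict_apply')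
            moreover have "p i \<in> ?U" "q i \<in> ?U"
              using pq True by (auto simp: permutes_in_image simp del: atLeastLessThan_iff)
            ultimately show ?thesis using G by (auto simp: bij_betw_def inj_on_def)
          next
            case False then show ?thesis using pq by (simp add: permutes_not_in)
          qed
        qed
      qed simp
    next
      fix p assume "p \<in> ?P"
      then have p: "bij_betw p ?U ?U" by (simp add: permutes_imp_bij)
      have "bij_betw (G \<circ> p) ?U R" using p G by (rule bij_betw_trans)
      then have "bij_betw (restrict (G \<circ> p) ?U) ?U R"
        by (rule iffD1[OF bij_betw_cong, rotated]) simp
      then show "restrict (G \<circ> p) ?U \<in> {f\<in>PiE ?U (\<lambda>_. F). inj_on f ?U \<and> f ` ?U = R}"
        using R by (auto simp: bij_betw_def)
    next
      fix f assume f: "f \<in> {f\<in>PiE ?U (\<lambda>_. F). inj_on f ?U \<and> f ` ?U = R}"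
      then have fb: "bij_betw f ?U R" by (auto simp: bij_betw_def)
      define p where "p i = (if i \<in> ?U then inv_into ?U G (f i) else i)" for i
      have "bij_betw (inv_into ?U G \<circ> f) ?U ?U"
        using fb bij_betw_inv_into[OF G] by (rule bij_betw_trans)
      then have "bij_betw p ?U ?U" by (rule iffD1[OF bij_betw_cong, rotated]) (simp add: p_def)
      then have "p permutes ?U" by (rule bij_imp_permutes) (simp add: p_def)
      moreover have "f = restrict (G \<circ> p) ?U"
      proof
        fix i show "f i = restrict (G \<circ> p) ?U i"
        proof (cases "i \<in> ?U")
          case True
          then have "f i \<in> G ` ?U" using f G by (auto simp: bij_betw_def)
          then have "G (inv_into ?U G (f i)) = f i" by (rule f_inv_into_f)
          then show ?thesis using True by (simp add: p_def)
        next
          case False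
          then show ?thesis using f by (auto simp: PiE_def extensional_def)
        qed
      qed
      ultimately show "\<exists>p\<in>?P. f = restrict (G \<circ> p) ?U" by blast
    qed
    also have "\<dots> = (\<Prod>r\<in>R. y r) * ?D * (\<Sum>p\<in>?P. signof p * (\<Prod>i\<in>?U. a i (G (p i))))"
      unfolding sum_distrib_left by (intro sum.cong refl val) simp
    also have "\<dots> = (\<Prod>r\<in>R. y r) * ?D\<^sup>2" by (simp add: fdef power2_eq_square mult_ac)
    finally show "(\<Sum>f\<in>{f\<in>PiE ?U (\<lambda>_. F). inj_on f ?U \<and> f ` ?U = R}. w f) =
        (\<Prod>r\<in>R. y r) * (fdet n (\<lambda>i k. a i (g R k)))\<^sup>2" by (simp add: G_def)
  qed
  finally show ?thesis .
qed

lemma fdet_eq_0_iff: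
  "fdet n M = 0 \<longleftrightarrow> (\<exists>c::nat \<Rightarrow> int. (\<exists>i<n. c i \<noteq> 0) \<and> (\<forall>k<n. (\<Sum>i<n. c i * M i k) = 0))"
proof -
  let ?A = "mat n n (\<lambda>(i,k). M k i)"
  have "?A = transpose_mat (mat n n (\<lambda>(i,k). M i k))" by (intro eq_matI) auto
  then have "fdet n M = det ?A" unfolding fdet_def by (metis det_transpose mat_carrier)
  then have "fdet n M = 0 \<longleftrightarrow> (\<exists>v. v \<in> carrier_vec n \<and> v \<noteq> 0\<^sub>v n \<and> ?A *\<^sub>v v = 0\<^sub>v n)"
    using det_0_iff_vec_prod_zero[of ?A n] by simp
  also have "\<dots> \<longleftrightarrow> (\<exists>c. (\<exists>i<n. c i \<noteq> 0) \<and> (\<forall>k<n. (\<Sum>i<n. c i * M i k) = 0))"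
  proof
    assume "\<exists>v. v \<in> carrier_vec n \<and> v \<noteq> 0\<^sub>v n \<and> ?A *\<^sub>v v = 0\<^sub>v n"
    then obtain v where v: "v \<in> carrier_vec n" "v \<noteq> 0\<^sub>v n" "?A *\<^sub>v v = 0\<^sub>v n" by blast
    have "\<exists>i<n. v $ i \<noteq> 0" using v(1,2) by (metis carrier_vecD eq_vecI index_zero_vec)
    moreover have "(\<Sum>i<n. v $ i * M i k) = 0" if "k < n" for k
    proof -
      have "(?A *\<^sub>v v) $ k = (\<Sum>i<n. v $ i * M i k)"
        using that v(1) by (auto simp: scalar_prod_def lessThan_atLeast0 mult.commute intro!: sum.cong)
      then show ?thesis using v(3) that by simp
    qed
    ultimately show "\<exists>c. (\<exists>i<n. c i \<noteq> 0) \<and> (\<forall>k<n. (\<Sum>i<n. c i * M i k) = 0)"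
      by (intro exI[of _ "\<lambda>i. v $ i"]) blast
  next
    assume "\<exists>c. (\<exists>i<n. c i \<noteq> 0) \<and> (\<forall>k<n. (\<Sum>i<n. c i * M i k) = 0)"
    then obtain c i where c: "i < n" "c i \<noteq> 0" "\<forall>k<n. (\<Sum>i<n. c i * M i k) = 0" by blast
    have "?A *\<^sub>v vec n c = 0\<^sub>v n"
    proof (rule eq_vecI)
      fix k assume "k < dim_vec (0\<^sub>v n :: int vec)"
      then show "(?A *\<^sub>v vec n c) $ k = 0\<^sub>v n $ k"
        using c(3) by (auto simp: scalar_prod_def lessThan_atLeast0 mult.commute)
    qed simp
    moreover have "vec n c \<noteq> 0\<^sub>v n" using c by (metis index_vec index_zero_vec(1))
    ultimately show "\<exists>v. v \<in> carrier_vec n \<and> v \<noteq> 0\<^sub>v n \<and> ?A *\<^sub>v v = 0\<^sub>v n"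
      by (intro exI[of _ "vec n c"]) simp
  qed
  finally show ?thesis .
qed

definition span_on :: "'i set \<Rightarrow> 'r set \<Rightarrow> ('i \<Rightarrow> 'r \<Rightarrow> int) \<Rightarrow> ('r \<Rightarrow> int) \<Rightarrow> bool" where
  "span_on I R z v \<longleftrightarrow> (\<exists>a. \<forall>r\<in>R. v r = (\<Sum>j\<in>I. a j * z j r))"

definition independent_on :: "'i set \<Rightarrow> 'r set \<Rightarrow> ('i \<Rightarrow> 'r \<Rightarrow> int) \<Rightarrow> bool" where
  "independent_on I R z \<longleftrightarrow> (\<forall>a. (\<forall>r\<in>R. (\<Sum>j\<in>I. a j * z j r) = 0) \<longrightarrow> (\<forall>j\<in>I. a j = 0))"

definition rationally_spanning_on :: "'i set \<Rightarrow> 'r set \<Rightarrow> ('i \<Rightarrow> 'r \<Rightarrow> int) \<Rightarrow> bool" where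
  "rationally_spanning_on I R z \<longleftrightarrow> (\<forall>v. \<exists>k::nat. k > 0 \<and> span_on I R z (\<lambda>r. int k * v r))"

lemma span_on_diff:
  assumes "span_on I R z u" "span_on I R z v"
  shows "span_on I R z (\<lambda>r. u r - v r)"
proof -
  from assms obtain a b where "\<forall>r\<in>R. u r = (\<Sum>j\<in>I. a j * z j r)" "\<forall>r\<in>R. v r = (\<Sum>j\<in>I. b j * z j r)"
    unfolding span_on_def by blast
  then show ?thesis unfolding span_on_def
    by (intro exI[of _ "\<lambda>j. a j - b j"]) (simp add: left_diff_distrib sum_subtractf)
qed

text \<open>If \<open>R\<close> were larger than \<open>I\<close>, the coefficient vectors that express multiples of the unit vectors would satisfy a
relation, and so would the unit vectors.\<close>

lemma card_eq_if_independent_spanning: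
  assumes fin: "finite I" "finite R"
    and ind: "independent_on I R z" and sp: "rationally_spanning_on I R z"
  shows "card R = card I"
proof (rule antisym)
  show "card I \<le> card R"
  proof (rule ccontr)
    assume "\<not> card I \<le> card R"
    with integer_relation[OF fin(2,1), of z] ind show False
      unfolding independent_on_def by (metis not_le)
  qed
  show "card R \<le> card I"
  proof (rule ccontr)
    assume less: "\<not> card R \<le> card I"
    have "\<exists>k::nat. \<exists>a. k > 0 \<and> (\<forall>r\<in>R. int k * (if r = s then 1 else 0) = (\<Sum>j\<in>I. a j * z j r))" for s
      using sp unfolding rationally_spanning_on_def span_on_def by fast
    then obtain k :: "'b \<Rightarrow> nat" and a where ka: "\<And>s. k s > 0"
      "\<And>s r. r \<in> R \<Longrightarrow> int (k s) * (if r = s then 1 else 0) = (\<Sum>j\<in>I. a s j * z j r)"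
      by metis
    from integer_relation[OF fin(1,2), of a] less obtain c where
      c: "\<exists>s\<in>R. c s \<noteq> 0" "\<And>j. j \<in> I \<Longrightarrow> (\<Sum>s\<in>R. c s * a s j) = 0" by auto
    have zero: "c r * int (k r) = 0" if r: "r \<in> R" for r
    proof -
      have "c r * int (k r) = (\<Sum>s\<in>R. if s = r then c s * int (k s) else 0)" using r fin by simp
      also have "\<dots> = (\<Sum>s\<in>R. c s * (int (k s) * (if r = s then 1 else 0)))"
        by (intro sum.cong) auto
      also have "\<dots> = (\<Sum>s\<in>R. \<Sum>j\<in>I. c s * a s j * z j r)"
        by (simp add: ka(2)[OF r] sum_distrib_left mult.assoc)
      also have "\<dots> = (\<Sum>j\<in>I. (\<Sum>s\<in>R. c s * a s j) * z j r)"
        unfolding sum_distrib_right by (rule sum.swap)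
      also have "\<dots> = 0" using c(2) by simp
      finally show ?thesis .
    qed
    obtain s where s: "s \<in> R" "c s \<noteq> 0" using c(1) by blast
    show False using zero[OF s(1)] s(2) ka(1)[of s] by simp
  qed
qed

text \<open>Pigeonhole: two multiples of a vector lie in the same coset as soon as there are finitely many cosets.\<close>

lemma rationally_spanning_if_transversal:
  fixes h :: "'x \<Rightarrow> 'r \<Rightarrow> int"
  assumes "finite Y" and trans: "\<And>v. \<exists>!x. x \<in> Y \<and> span_on I R z (\<lambda>r. v r - h x r)"
  shows "rationally_spanning_on I R z"
  unfolding rationally_spanning_on_def
proof
  fix v :: "'r \<Rightarrow> int"
  have "\<forall>m::nat. \<exists>x. x \<in> Y \<and> span_on I R z (\<lambda>r. int m * v r - h x r)"
    using ex1_implies_ex[OF trans] by fast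
  then obtain f where f: "\<And>m::nat. f m \<in> Y" "\<And>m. span_on I R z (\<lambda>r. int m * v r - h (f m) r)"
    by metis
  have "\<not> inj f" using f(1) assms(1) by (meson finite_subset image_subsetI infinite_UNIV_nat inj_on_finite)
  then obtain m m' where "m \<noteq> m'" "f m = f m'" by (auto simp: inj_on_def)
  then obtain m m' where mm: "m < m'" "f m = f m'" by (metis nat_neq_iff)
  have "span_on I R z (\<lambda>r. (int m' * v r - h (f m') r) - (int m * v r - h (f m) r))"
    by (rule span_on_diff) (rule f)+
  also have "(\<lambda>r. (int m' * v r - h (f m') r) - (int m * v r - h (f m) r)) = (\<lambda>r. int (m' - m) * v r)"
    using mm by (auto simp: of_nat_diff algebra_simps)
  finally show "\<exists>k::nat. k > 0 \<and> span_on I R z (\<lambda>r. int k * v r)"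
    using mm by (intro exI[of _ "m' - m"]) auto
qed

context
  fixes I :: "'i set" and R :: "'r set" and z :: "'i \<Rightarrow> 'r \<Rightarrow> int" and n :: nat
    and e :: "nat \<Rightarrow> 'i" and g :: "nat \<Rightarrow> 'r"
  assumes e: "bij_betw e {0..<n} I" and g: "bij_betw g {0..<n} R"
begin

lemma sum_enum: "(\<Sum>j\<in>I. f j) = (\<Sum>i<n. f (e i))"
  using sum.reindex_bij_betw[OF e, of f] by (simp add: lessThan_atLeast0)

lemma ball_enum: "(\<forall>r\<in>R. P r) \<longleftrightarrow> (\<forall>k<n. P (g k))"
  using g by (auto simp: bij_betw_def)

lemma ball_rows: "(\<forall>j\<in>I. P j) \<longleftrightarrow> (\<forall>i<n. P (e i))"
  using e by (auto simp: bij_betw_def)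

lemma independent_on_iff_fdet: "independent_on I R z \<longleftrightarrow> fdet n (\<lambda>i k. z (e i) (g k)) \<noteq> 0"
proof -
  have inv: "inv_into {0..<n} e (e i) = i" if "i < n" for i
    using that e by (simp add: bij_betw_def inv_into_f_f)
  have "\<not> independent_on I R z \<longleftrightarrow> (\<exists>a. (\<exists>i<n. a (e i) \<noteq> 0) \<and> (\<forall>k<n. (\<Sum>i<n. a (e i) * z (e i) (g k)) = 0))"
    unfolding independent_on_def ball_enum sum_enum ball_rows by blast
  also have "\<dots> \<longleftrightarrow> (\<exists>c. (\<exists>i<n. c i \<noteq> 0) \<and> (\<forall>k<n. (\<Sum>i<n. c i * z (e i) (g k)) = 0))"
  proof
    assume "\<exists>c. (\<exists>i<n. c i \<noteq> 0) \<and> (\<forall>k<n. (\<Sum>i<n. c i * z (e i) (g k)) = 0)"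
    then obtain c where c: "\<exists>i<n. c i \<noteq> 0" "\<forall>k<n. (\<Sum>i<n. c i * z (e i) (g k)) = 0" by blast
    show "\<exists>a. (\<exists>i<n. a (e i) \<noteq> 0) \<and> (\<forall>k<n. (\<Sum>i<n. a (e i) * z (e i) (g k)) = 0)"
    proof (intro exI[of _ "c \<circ> inv_into {0..<n} e"] conjI)
      obtain i where "i < n" "c i \<noteq> 0" using c(1) by blast
      then show "\<exists>i<n. (c \<circ> inv_into {0..<n} e) (e i) \<noteq> 0"
        by (intro exI[of _ i]) (simp add: inv)
    qed (use c(2) in \<open>simp add: inv\<close>)
  qed (blast intro: exI[of _ "\<lambda>i. a (e i)" for a])
  finally show ?thesis unfolding fdet_eq_0_iff by blast
qed

lemma transversal_if_fdet:
  assumes "fdet n (\<lambda>i k. z (e i) (g k)) \<noteq> 0"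
  shows "\<exists>Y (h :: (nat \<Rightarrow> int) \<Rightarrow> 'r \<Rightarrow> int). finite Y \<and> card Y = nat \<bar>fdet n (\<lambda>i k. z (e i) (g k))\<bar> \<and>
     (\<forall>v. \<exists>!x. x \<in> Y \<and> span_on I R z (\<lambda>r. v r - h x r))"
proof -
  define h where "h x r = x (inv_into {0..<n} g r)" for x :: "nat \<Rightarrow> int" and r
  have hg: "h x (g k) = x k" if "k < n" for x k
    using that g by (simp add: h_def bij_betw_def inv_into_f_f)
  have inv: "inv_into {0..<n} e (e i) = i" if "i < n" for i
    using that e by (simp add: bij_betw_def inv_into_f_f)
  have eq: "in_row_lattice n (\<lambda>i k. z (e i) (g k)) (\<lambda>k. v (g k) - x k) \<longleftrightarrow> span_on I R z (\<lambda>r. v r - h x r)" for v x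
    unfolding in_row_lattice_def span_on_def ball_enum sum_enum
  proof
    assume "\<exists>c. \<forall>j<n. v (g j) - x j = (\<Sum>i<n. c i * z (e i) (g j))"
    then obtain c where "\<forall>j<n. v (g j) - x j = (\<Sum>i<n. c i * z (e i) (g j))" by blast
    then show "\<exists>a. \<forall>k<n. v (g k) - h x (g k) = (\<Sum>i<n. a (e i) * z (e i) (g k))"
      by (intro exI[of _ "c \<circ> inv_into {0..<n} e"]) (simp add: inv hg)
  next
    assume "\<exists>a. \<forall>k<n. v (g k) - h x (g k) = (\<Sum>i<n. a (e i) * z (e i) (g k))"
    then obtain a where "\<forall>k<n. v (g k) - h x (g k) = (\<Sum>i<n. a (e i) * z (e i) (g k))" by blast
    then show "\<exists>c. \<forall>j<n. v (g j) - x j = (\<Sum>i<n. c i * z (e i) (g j))"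
      by (intro exI[of _ "\<lambda>i. a (e i)"]) (simp add: hg)
  qed
  from row_lattice_transversal[OF assms] obtain Y where Y: "finite Y"
    "card Y = nat \<bar>fdet n (\<lambda>i k. z (e i) (g k))\<bar>" "row_transversal n (\<lambda>i k. z (e i) (g k)) Y" by blast
  show ?thesis
  proof (intro exI[of _ Y] exI[of _ h] conjI allI)
    fix v
    show "\<exists>!x. x \<in> Y \<and> span_on I R z (\<lambda>r. v r - h x r)"
      using Y(3)[unfolded row_transversal_def, rule_format, of "\<lambda>k. v (g k)"] unfolding eq .
  qed (use Y in auto)
qed

end

section \<open>Rank and torsion of reduced homology\<close>

definition removal_sign :: "'v::linorder \<Rightarrow> 'v set \<Rightarrow> int" where
  "removal_sign v \<sigma> = (-1) ^ card {w \<in> \<sigma>. w < v}"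

lemma face_boundary_alt:
  "face_boundary \<sigma> = (\<Sum>v\<in>\<sigma>. frag_cmul (removal_sign v \<sigma>) (frag_of (\<sigma> - {v})))"
  by (simp add: face_boundary_def removal_sign_def)

lemma removal_sign_squared [simp]: "removal_sign v \<sigma> * removal_sign v \<sigma> = 1"
  by (simp add: removal_sign_def flip: power_mult_distrib)

text \<open>Only the later of the two vertices notices the removal of the other, whence exactly one sign flips. This one
identity accounts both for the vanishing of the squared boundary and for the cone homotopy below.\<close>

lemma removal_sign_swap:
  assumes "finite \<sigma>" "v \<in> \<sigma>" "w \<in> \<sigma>" "v \<noteq> w"
  shows "removal_sign v \<sigma> * removal_sign w (\<sigma> - {v}) =
         - (removal_sign w \<sigma> * removal_sign v (\<sigma> - {w}))"
proof -
  have *: "removal_sign v \<sigma> * removal_sign w (\<sigma> - {v}) =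
         - (removal_sign w \<sigma> * removal_sign v (\<sigma> - {w}))" if "v \<in> \<sigma>" "w \<in> \<sigma>" "v < w" for v w
  proof -
    have "{u \<in> \<sigma> - {w}. u < v} = {u \<in> \<sigma>. u < v}" using that by auto
    moreover have "{u \<in> \<sigma>. u < w} = insert v {u \<in> \<sigma> - {v}. u < w}" using that by auto
    then have "card {u \<in> \<sigma>. u < w} = Suc (card {u \<in> \<sigma> - {v}. u < w})"
      using assms(1) by simp
    ultimately show ?thesis by (simp add: removal_sign_def)
  qed
  show ?thesis using *[of v w] *[of w v] assms by (cases "v < w") auto
qed

lemma boundary_map_simps:
  "boundary_map (a + b) = boundary_map a + boundary_map b"
  "boundary_map (a - b) = boundary_map a - boundary_map b"
  "boundary_map (- a) = - boundary_map a"
  "boundary_map (frag_cmul k a) = frag_cmul k (boundary_map a)"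
  "boundary_map 0 = 0"
  "boundary_map (frag_of \<sigma>) = face_boundary \<sigma>"
  by (simp_all add: boundary_map_def frag_extend_add frag_extend_diff frag_extend_minus frag_extend_cmul)

lemma boundary_map_sum: "boundary_map (\<Sum>i\<in>I. f i) = (\<Sum>i\<in>I. boundary_map (f i))"
  by (induction I rule: infinite_finite_induct) (auto simp: boundary_map_simps)

text \<open>Removing two vertices in either order gives the same face with opposite signs, so the sum over ordered pairs is
its own negative.\<close>

lemma boundary_face_boundary: "boundary_map (face_boundary \<sigma>) = 0"
proof (cases "finite \<sigma>")
  case True
  define t where "t v w = frag_cmul (removal_sign v \<sigma> * removal_sign w (\<sigma> - {v})) (frag_of (\<sigma> - {v} - {w}))" for v w
  define S where "S = Sigma \<sigma> (\<lambda>v. \<sigma> - {v})"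
  have "boundary_map (face_boundary \<sigma>) = (\<Sum>v\<in>\<sigma>. \<Sum>w\<in>\<sigma>-{v}. t v w)"
    unfolding face_boundary_alt[of \<sigma>] boundary_map_sum boundary_map_simps t_def
    by (simp add: face_boundary_alt frag_cmul_sum)
  also have "\<dots> = (\<Sum>(v,w)\<in>S. t v w)"
    unfolding S_def using True by (subst sum.Sigma) auto
  finally have eq: "boundary_map (face_boundary \<sigma>) = (\<Sum>(v,w)\<in>S. t v w)" .
  have "(\<Sum>(v,w)\<in>S. t v w) = (\<Sum>(v,w)\<in>S. t w v)"
    by (rule sum.reindex_bij_witness[of _ prod.swap prod.swap]) (auto simp: S_def)
  also have "\<dots> = (\<Sum>(v,w)\<in>S. - t v w)"
  proof (rule sum.cong[OF refl], clarify)
    fix v w assume "(v, w) \<in> S"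
    then have "v \<in> \<sigma>" "w \<in> \<sigma>" "v \<noteq> w" by (auto simp: S_def)
    moreover have "\<sigma> - {v} - {w} = \<sigma> - {w} - {v}" by auto
    ultimately show "t w v = - t v w"
      unfolding t_def using removal_sign_swap[OF True, of v w] by simp
  qed
  also have "\<dots> = - (\<Sum>(v,w)\<in>S. t v w)"
    by (simp add: sum_negf case_prod_unfold)
  finally have neg: "(\<Sum>(v,w)\<in>S. t v w) = - (\<Sum>(v,w)\<in>S. t v w)" .
  have "p = 0" if "p = - p" for p :: "'a set \<Rightarrow>\<^sub>0 int"
  proof (rule poly_mapping_eqI)
    fix u have "Poly_Mapping.lookup p u = Poly_Mapping.lookup (- p) u" by (subst (1) that) simp
    then have "Poly_Mapping.lookup p u = - Poly_Mapping.lookup p u" by simp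
    then show "Poly_Mapping.lookup p u = Poly_Mapping.lookup 0 u" by simp
  qed
  from this[OF neg] show ?thesis using eq by simp
qed (simp add: face_boundary_def boundary_map_simps)

lemma boundary_boundary: "boundary_map (boundary_map c) = 0"
  using subset_UNIV
proof (induction c rule: frag_induction)
  case (diff a b) then show ?case by (simp add: boundary_map_simps)
qed (auto simp: boundary_map_simps boundary_face_boundary)

lemma keys_boundary_map:
  fixes K :: "'v::linorder set set"
  assumes "\<forall>\<sigma>\<in>K. \<forall>\<tau>. \<tau> \<subseteq> \<sigma> \<longrightarrow> \<tau> \<in> K" and c: "Poly_Mapping.keys c \<subseteq> faces K (i + 1)"
  shows "Poly_Mapping.keys (boundary_map c) \<subseteq> faces K i"
proof -
  have "Poly_Mapping.keys (face_boundary \<sigma>) \<subseteq> faces K i" if s: "\<sigma> \<in> faces K (i + 1)" for \<sigma>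
  proof
    fix \<tau> assume "\<tau> \<in> Poly_Mapping.keys (face_boundary \<sigma>)"
    then obtain v where v: "finite \<sigma>" "v \<in> \<sigma>" "\<tau> = \<sigma> - {v}"
      unfolding face_boundary_def using keys_sum[of "\<lambda>v. frag_cmul ((-1) ^ card {w \<in> \<sigma>. w < v}) (frag_of (\<sigma> - {v}))" \<sigma>]
      by (cases "finite \<sigma>") auto
    have "card \<sigma> > 0" using v by (auto simp: card_gt_0_iff)
    then show "\<tau> \<in> faces K i" using s assms(1) v
      by (auto simp: faces_def face_dim_def card_Diff_singleton)
  qed
  then show ?thesis using keys_frag_extend[of face_boundary c] c
    unfolding boundary_map_def by blast
qed

lemma subgroup_cycles: "subgroup (cycles K i) (chain_grp K i)"
  unfolding chain_grp_def cycles_def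
  by unfold_locales
     (auto simp: boundary_map_simps keys_minus dest!: subsetD[OF keys_add])

lemma subgroup_boundaries:
  assumes "\<forall>\<sigma>\<in>K. \<forall>\<tau>. \<tau> \<subseteq> \<sigma> \<longrightarrow> \<tau> \<in> K"
  shows "subgroup (boundaries K i) (chain_grp K i)"
proof -
  have *: "Poly_Mapping.keys (a + b) \<subseteq> Y" if "Poly_Mapping.keys a \<subseteq> Y" "Poly_Mapping.keys b \<subseteq> Y" for a b :: "'a set \<Rightarrow>\<^sub>0 int" and Y
    using that keys_add[of a b] by blast
  show ?thesis
    unfolding chain_grp_def boundaries_def
  proof (unfold_locales)
    show "boundary_map ` carrier (free_Abelian_group (faces K (i + 1))) \<subseteq> carrier (free_Abelian_group (faces K i))"
      using keys_boundary_map[OF assms] by auto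
  next
    fix x y assume "x \<in> boundary_map ` carrier (free_Abelian_group (faces K (i + 1)))"
      "y \<in> boundary_map ` carrier (free_Abelian_group (faces K (i + 1)))"
    then obtain a b where "x = boundary_map a" "y = boundary_map b"
      "Poly_Mapping.keys a \<subseteq> faces K (i+1)" "Poly_Mapping.keys b \<subseteq> faces K (i+1)" by auto
    then show "x \<otimes>\<^bsub>free_Abelian_group (faces K i)\<^esub> y
      \<in> boundary_map ` carrier (free_Abelian_group (faces K (i + 1)))"
      using * by (auto simp: boundary_map_simps intro!: image_eqI[of _ _ "a + b"])
  next
    show "\<one>\<^bsub>free_Abelian_group (faces K i)\<^esub>
      \<in> boundary_map ` carrier (free_Abelian_group (faces K (i + 1)))"
      by (auto simp: boundary_map_simps intro!: image_eqI[of _ _ 0])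
  next
    fix x assume "x \<in> boundary_map ` carrier (free_Abelian_group (faces K (i + 1)))"
    then obtain a where a: "x = boundary_map a" "Poly_Mapping.keys a \<subseteq> faces K (i+1)" by auto
    then have "Poly_Mapping.keys x \<subseteq> faces K i" using keys_boundary_map[OF assms] by blast
    then show "inv\<^bsub>free_Abelian_group (faces K i)\<^esub> x
      \<in> boundary_map ` carrier (free_Abelian_group (faces K (i + 1)))"
      using a by (auto simp: boundary_map_simps keys_minus intro!: image_eqI[of _ _ "- a"])
  qed
qed

lemma boundaries_subset_cycles:
  assumes "\<forall>\<sigma>\<in>K. \<forall>\<tau>. \<tau> \<subseteq> \<sigma> \<longrightarrow> \<tau> \<in> K"
  shows "boundaries K i \<subseteq> cycles K i"
  using subgroup.subset[OF subgroup_boundaries[OF assms, of i]]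
  by (auto simp: boundaries_def cycles_def boundary_boundary)

lemma cycles_closed:
  "0 \<in> cycles K i"
  "a \<in> cycles K i \<Longrightarrow> b \<in> cycles K i \<Longrightarrow> a + b \<in> cycles K i"
  "a \<in> cycles K i \<Longrightarrow> frag_cmul k a \<in> cycles K i"
  "a \<in> cycles K i \<Longrightarrow> - a \<in> cycles K i"
  "a \<in> cycles K i \<Longrightarrow> b \<in> cycles K i \<Longrightarrow> a - b \<in> cycles K i"
  using keys_add[of a b] keys_diff[of a b] keys_cmul[of k a]
  by (auto simp: cycles_def chain_grp_def boundary_map_simps keys_minus)

lemma cycles_sum: "(\<And>x. x \<in> S \<Longrightarrow> f x \<in> cycles K i) \<Longrightarrow> sum f S \<in> cycles K i"
  by (induction S rule: infinite_finite_induct) (auto simp: cycles_closed)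

text \<open>The map from cycles to homology classes, described only by the properties that are needed; this avoids
computing with cosets.\<close>

definition homology_projection ::
    "'v::linorder set set \<Rightarrow> int \<Rightarrow> (('v set \<Rightarrow>\<^sub>0 int) \<Rightarrow> ('v set \<Rightarrow>\<^sub>0 int) set) \<Rightarrow> bool" where
  "homology_projection K i q \<longleftrightarrow> comm_group (reduced_homology K i) \<and>
    carrier (reduced_homology K i) = q ` cycles K i \<and>
    (\<forall>z\<in>cycles K i. q z = \<one>\<^bsub>reduced_homology K i\<^esub> \<longleftrightarrow> z \<in> boundaries K i) \<and>
    (\<forall>z\<in>cycles K i. \<forall>w\<in>cycles K i. q (z + w) = q z \<otimes>\<^bsub>reduced_homology K i\<^esub> q w) \<and>
    (\<forall>z\<in>cycles K i. \<forall>k::int. q z [^]\<^bsub>reduced_homology K i\<^esub> k = q (frag_cmul k z))"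

lemma homology_projectionD:
  assumes "homology_projection K i q"
  shows "comm_group (reduced_homology K i)"
    and "carrier (reduced_homology K i) = q ` cycles K i"
    and "z \<in> cycles K i \<Longrightarrow> q z = \<one>\<^bsub>reduced_homology K i\<^esub> \<longleftrightarrow> z \<in> boundaries K i"
    and "z \<in> cycles K i \<Longrightarrow> w \<in> cycles K i \<Longrightarrow> q (z + w) = q z \<otimes>\<^bsub>reduced_homology K i\<^esub> q w"
    and "z \<in> cycles K i \<Longrightarrow> q z [^]\<^bsub>reduced_homology K i\<^esub> (k::int) = q (frag_cmul k z)"
  using assms by (simp_all add: homology_projection_def)

lemma homology_projection_exists:
  assumes "\<forall>\<sigma>\<in>K. \<forall>\<tau>. \<tau> \<subseteq> \<sigma> \<longrightarrow> \<tau> \<in> K"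
  shows "\<exists>q. homology_projection K i q"
proof -
  let ?G = "chain_grp K i" and ?Z = "cycles K i" and ?B = "boundaries K i"
  define A where "A = subgroup_generated ?G ?Z"
  have G: "comm_group ?G" by (simp add: chain_grp_def abelian_free_Abelian_group)
  then interpret G: comm_group ?G .
  have cA: "carrier A = ?Z" unfolding A_def
    by (rule subgroup.carrier_subgroup_generated_subgroup[OF subgroup_cycles])
  have "comm_group A" unfolding A_def by (rule G.abelian_subgroup_generated[OF G])
  then interpret A: comm_group A .
  have B: "subgroup ?B A" unfolding A_def
    by (rule G.subgroup_of_subgroup_generated[OF boundaries_subset_cycles[OF assms] subgroup_boundaries[OF assms]])
  then have N: "?B \<lhd> A" by (simp add: A.normal_iff_subgroup)
  have H: "reduced_homology K i = A Mod ?B" by (simp add: reduced_homology_def A_def)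
  have mA: "x \<otimes>\<^bsub>A\<^esub> y = x + y" for x y by (simp add: A_def chain_grp_def)
  define q where "q z = ?B #>\<^bsub>A\<^esub> z" for z
  let ?H = "reduced_homology K i"
  have cg: "comm_group ?H" unfolding H by (rule A.abelian_FactGroup[OF B])
  interpret H: comm_group ?H by (rule cg)
  have cH: "carrier ?H = q ` ?Z"
    by (simp add: H carrier_FactGroup cA q_def)
  have one: "q z = \<one>\<^bsub>?H\<^esub> \<longleftrightarrow> z \<in> ?B" if "z \<in> ?Z" for z
    using that A.coset_join1[of ?B z] A.coset_join2[of z ?B] B cA by (auto simp: H q_def)
  have add: "q (z + w) = q z \<otimes>\<^bsub>?H\<^esub> q w" if "z \<in> ?Z" "w \<in> ?Z" for z w
    using hom_mult[OF normal.r_coset_hom_Mod[OF N]] that cA mA by (metis H q_def)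
  have "0 \<in> ?B"
    unfolding boundaries_def chain_grp_def by (auto intro!: image_eqI[of _ _ 0] simp: boundary_map_simps)
  then have q0: "q 0 = \<one>\<^bsub>?H\<^esub>" by (simp add: one cycles_closed)
  have qcar: "q z \<in> carrier ?H" if "z \<in> ?Z" for z using that cH by blast
  have npow: "q z [^]\<^bsub>?H\<^esub> k = q (frag_cmul (int k) z)" if z: "z \<in> ?Z" for z and k :: nat
  proof (induction k)
    case 0 show ?case by (simp add: q0)
  next
    case (Suc k)
    have "q (frag_cmul (int (Suc k)) z) = q (frag_cmul (int k) z + z)"
      by (simp add: frag_cmul_distrib add.commute)
    then show ?case using z Suc by (simp add: add cycles_closed)
  qed
  have neg: "inv\<^bsub>?H\<^esub> (q z) = q (- z)" if "z \<in> ?Z" for z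
    by (rule H.inv_equality) (use that in \<open>auto simp: qcar cycles_closed q0 simp flip: add\<close>)
  have pow: "q z [^]\<^bsub>?H\<^esub> c = q (frag_cmul c z)" if z: "z \<in> ?Z" for z and c :: int
  proof (cases "c \<ge> 0")
    case True
    then obtain k where "c = int k" by (metis nonneg_int_cases)
    then show ?thesis using npow[OF z] by (simp add: int_pow_int)
  next
    case False
    then obtain k where k: "c = - int k" by (metis linear nonpos_int_cases)
    then have "q z [^]\<^bsub>?H\<^esub> c = inv\<^bsub>?H\<^esub> (q (frag_cmul (int k) z))"
      using npow[OF z] by (simp add: H.int_pow_neg int_pow_int qcar z)
    also have "\<dots> = q (frag_cmul c z)" using z k by (simp add: neg cycles_closed)
    finally show ?thesis .
  qed
  show ?thesis unfolding homology_projection_def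
    by (intro exI[of _ q] conjI ballI allI) (simp_all add: cg cH one add pow)
qed

text \<open>The uniform bound on independent sets makes the maximum in the definition of the rank meaningful.\<close>

lemma Z_rank_eq_0_iff_torsion:
  assumes "comm_group G" and bound: "\<And>B. Z_independent G B \<Longrightarrow> card B \<le> N"
  shows "Z_rank G = 0 \<longleftrightarrow> torsion_subgroup G = carrier G"
proof -
  interpret comm_group G by fact
  have "finite (card ` {B. Z_independent G B})"
    by (rule finite_subset[of _ "{..N}"]) (auto dest: bound)
  moreover have "Z_independent G {}" by (simp add: Z_independent_def)
  ultimately have "Z_rank G = 0 \<longleftrightarrow> (\<forall>B. Z_independent G B \<longrightarrow> card B = 0)"
    unfolding Z_rank_def by (subst Max_eq_iff) force+
  also have "\<dots> \<longleftrightarrow> (\<forall>x\<in>carrier G. \<exists>k::nat. k > 0 \<and> x [^]\<^bsub>G\<^esub> k = \<one>\<^bsub>G\<^esub>)"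
  proof (intro iffI ballI allI impI)
    fix x assume *: "\<forall>B. Z_independent G B \<longrightarrow> card B = 0" and x: "x \<in> carrier G"
    have "\<not> Z_independent G {x}" using *[rule_format, of "{x}"] by auto
    then obtain c :: int where c: "x [^]\<^bsub>G\<^esub> c = \<one>\<^bsub>G\<^esub>" "c \<noteq> 0"
      using x by (auto simp: Z_independent_def)
    then show "\<exists>k::nat. k > 0 \<and> x [^]\<^bsub>G\<^esub> k = \<one>\<^bsub>G\<^esub>"
    proof (cases "c > 0")
      case True
      then have "c = int (nat c)" by simp
      then have "x [^]\<^bsub>G\<^esub> (nat c) = \<one>\<^bsub>G\<^esub>" using c by (metis int_pow_int)
      then show ?thesis using True by (intro exI[of _ "nat c"]) auto
    next
      case False
      have "x [^]\<^bsub>G\<^esub> (- c) = \<one>\<^bsub>G\<^esub>" using c x by (simp add: int_pow_neg)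
      moreover have "- c = int (nat (- c))" using False by simp
      ultimately have "x [^]\<^bsub>G\<^esub> (nat (- c)) = \<one>\<^bsub>G\<^esub>" by (metis int_pow_int)
      then show ?thesis using False c by (intro exI[of _ "nat (- c)"]) auto
    qed
  next
    fix B assume *: "\<forall>x\<in>carrier G. \<exists>k::nat. k > 0 \<and> x [^]\<^bsub>G\<^esub> k = \<one>\<^bsub>G\<^esub>" and B: "Z_independent G B"
    show "card B = 0"
    proof (rule ccontr)
      assume "card B \<noteq> 0"
      then obtain x where x: "x \<in> B" by fastforce
      have fB: "finite B" "B \<subseteq> carrier G" using B by (auto simp: Z_independent_def)
      with x * obtain k :: nat where k: "k > 0" "x [^]\<^bsub>G\<^esub> k = \<one>\<^bsub>G\<^esub>" by blast
      define c where "c y = (if y = x then int k else 0)" for y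
      have "y [^]\<^bsub>G\<^esub> c y = \<one>\<^bsub>G\<^esub>" for y using k by (simp add: c_def int_pow_int)
      then have "finprod G (\<lambda>y. y [^]\<^bsub>G\<^esub> c y) B = \<one>\<^bsub>G\<^esub>" by (simp add: finprod_one)
      then have "c x = 0" using B x by (auto simp: Z_independent_def)
      then show False using k by (simp add: c_def)
    qed
  qed
  also have "\<dots> \<longleftrightarrow> torsion_subgroup G = carrier G" by (auto simp: torsion_subgroup_def)
  finally show ?thesis .
qed

context
  fixes K :: "'v::linorder set set" and i :: int
  assumes down: "\<forall>\<sigma>\<in>K. \<forall>\<tau>. \<tau> \<subseteq> \<sigma> \<longrightarrow> \<tau> \<in> K"
begin

lemma homology_torsion_iff:
  "torsion_subgroup (reduced_homology K i) = carrier (reduced_homology K i) \<longleftrightarrow>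
     (\<forall>z\<in>cycles K i. \<exists>k::nat. k > 0 \<and> frag_cmul (int k) z \<in> boundaries K i)"
proof -
  let ?H = "reduced_homology K i"
  obtain q where q: "homology_projection K i q" using homology_projection_exists[OF down] by blast
  note cH = homology_projectionD(2)[OF q] and one = homology_projectionD(3)[OF q]
    and add = homology_projectionD(4)[OF q] and pow = homology_projectionD(5)[OF q]
  interpret H: comm_group ?H by (rule homology_projectionD(1)[OF q])
  have eq: "(q z [^]\<^bsub>?H\<^esub> k = \<one>\<^bsub>?H\<^esub>) \<longleftrightarrow> frag_cmul (int k) z \<in> boundaries K i"
    if "z \<in> cycles K i" for z and k :: nat
    using that pow[of z "int k"] by (simp add: int_pow_int one cycles_closed)
  have "torsion_subgroup ?H = carrier ?H \<longleftrightarrow>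
      (\<forall>z\<in>cycles K i. \<exists>k::nat. k > 0 \<and> q z [^]\<^bsub>?H\<^esub> k = \<one>\<^bsub>?H\<^esub>)"
    unfolding torsion_subgroup_def cH by blast
  then show ?thesis using eq by simp
qed

text \<open>Representing cycles of more classes than there are faces satisfy an integer relation, which descends to the
classes.\<close>

lemma homology_rank_bounded:
  assumes fin: "finite (faces K i)" and ind: "Z_independent (reduced_homology K i) B"
  shows "card B \<le> card (faces K i)"
proof (rule ccontr)
  assume "\<not> card B \<le> card (faces K i)"
  then have less: "card (faces K i) < card B" by simp
  let ?H = "reduced_homology K i"
  obtain q where q: "homology_projection K i q" using homology_projection_exists[OF down] by blast
  note cH = homology_projectionD(2)[OF q] and one = homology_projectionD(3)[OF q]
    and add = homology_projectionD(4)[OF q] and pow = homology_projectionD(5)[OF q]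
  interpret H: comm_group ?H by (rule homology_projectionD(1)[OF q])
  have q0: "q 0 = \<one>\<^bsub>?H\<^esub>" using pow[of 0 0] by (simp add: cycles_closed)
  have finB: "finite B" and BH: "B \<subseteq> q ` cycles K i" using ind cH by (auto simp: Z_independent_def)
  define r where "r = inv_into (cycles K i) q"
  have r: "r b \<in> cycles K i \<and> q (r b) = b" if "b \<in> B" for b
  proof -
    have "b \<in> q ` cycles K i" using that BH by blast
    then show ?thesis unfolding r_def by (simp add: inv_into_into f_inv_into_f)
  qed
  from integer_relation[OF fin finB less, of "\<lambda>b \<sigma>. Poly_Mapping.lookup (r b) \<sigma>"] obtain c
    where c: "\<exists>b\<in>B. c b \<noteq> 0" "\<And>\<sigma>. \<sigma> \<in> faces K i \<Longrightarrow> (\<Sum>b\<in>B. c b * Poly_Mapping.lookup (r b) \<sigma>) = 0" by blast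
  have prod: "finprod ?H (\<lambda>b. b [^]\<^bsub>?H\<^esub> c b) C = q (\<Sum>b\<in>C. frag_cmul (c b) (r b))" if "C \<subseteq> B" for C
    using finite_subset[OF that finB] that
  proof (induction C rule: finite_induct)
    case (insert b C)
    have "finprod ?H (\<lambda>b. b [^]\<^bsub>?H\<^esub> c b) (insert b C) =
        b [^]\<^bsub>?H\<^esub> c b \<otimes>\<^bsub>?H\<^esub> finprod ?H (\<lambda>b. b [^]\<^bsub>?H\<^esub> c b) C"
    proof (rule H.finprod_insert)
      have "B \<subseteq> carrier ?H" using BH cH by simp
      then show "(\<lambda>b. b [^]\<^bsub>?H\<^esub> c b) \<in> C \<rightarrow> carrier ?H" "b [^]\<^bsub>?H\<^esub> c b \<in> carrier ?H"
        using insert by (auto simp del: cH intro!: H.int_pow_closed)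
    qed (use insert in auto)
    also have "b [^]\<^bsub>?H\<^esub> c b = q (frag_cmul (c b) (r b))" using r[of b] pow[of "r b" "c b"] insert by auto
    also have "finprod ?H (\<lambda>b. b [^]\<^bsub>?H\<^esub> c b) C = q (\<Sum>b\<in>C. frag_cmul (c b) (r b))"
      using insert by simp
    also have "q (frag_cmul (c b) (r b)) \<otimes>\<^bsub>?H\<^esub> q (\<Sum>b\<in>C. frag_cmul (c b) (r b)) =
        q (frag_cmul (c b) (r b) + (\<Sum>b\<in>C. frag_cmul (c b) (r b)))"
      using insert r by (intro add[symmetric] cycles_closed cycles_sum) auto
    finally show ?case using insert by simp
  qed (simp add: q0)
  have rkeys: "Poly_Mapping.keys (r b) \<subseteq> faces K i" if "b \<in> B" for b
    using r[OF that] by (simp add: cycles_def chain_grp_def)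
  have lsum: "Poly_Mapping.lookup (\<Sum>b\<in>C. frag_cmul (c b) (r b)) \<sigma> = (\<Sum>b\<in>C. c b * Poly_Mapping.lookup (r b) \<sigma>)" for \<sigma> C
    by (simp add: Poly_Mapping.lookup_sum)
  have "(\<Sum>b\<in>B. frag_cmul (c b) (r b)) = 0"
  proof (rule poly_mapping_eqI)
    fix \<sigma>
    show "Poly_Mapping.lookup (\<Sum>b\<in>B. frag_cmul (c b) (r b)) \<sigma> = Poly_Mapping.lookup 0 \<sigma>"
    proof (cases "\<sigma> \<in> faces K i")
      case True then show ?thesis using c(2) by (simp add: lsum)
    next
      case False
      then have "Poly_Mapping.lookup (r b) \<sigma> = 0" if "b \<in> B" for b using rkeys[OF that] by (meson in_keys_iff subsetD)
      then show ?thesis by (simp add: lsum)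
    qed
  qed
  then have "finprod ?H (\<lambda>b. b [^]\<^bsub>?H\<^esub> c b) B = \<one>\<^bsub>?H\<^esub>" using prod[of B] q0 by simp
  then show False using ind c(1) by (auto simp: Z_independent_def)
qed

lemma betti_eq_0_iff:
  assumes "finite (faces K i)"
  shows "betti K i = 0 \<longleftrightarrow> (\<forall>z\<in>cycles K i. \<exists>k::nat. k > 0 \<and> frag_cmul (int k) z \<in> boundaries K i)"
proof -
  have "comm_group (reduced_homology K i)" using homology_projection_exists[OF down] homology_projectionD(1) by blast
  from Z_rank_eq_0_iff_torsion[OF this homology_rank_bounded[OF assms]]
  show ?thesis unfolding betti_def homology_torsion_iff .
qed

lemma torsion_number_eq_card_transversal:
  assumes fin: "finite (faces K i)" and "betti K i = 0"
    and rep: "\<And>x. x \<in> Y \<Longrightarrow> f x \<in> cycles K i"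
    and trans: "\<And>z. z \<in> cycles K i \<Longrightarrow> \<exists>!x. x \<in> Y \<and> z - f x \<in> boundaries K i"
  shows "torsion_number K i = card Y"
proof -
  let ?H = "reduced_homology K i"
  obtain q where q: "homology_projection K i q" using homology_projection_exists[OF down] by blast
  note cH = homology_projectionD(2)[OF q] and one = homology_projectionD(3)[OF q]
    and add = homology_projectionD(4)[OF q] and pow = homology_projectionD(5)[OF q]
  interpret H: comm_group ?H by (rule homology_projectionD(1)[OF q])
  have eq: "q z = q w \<longleftrightarrow> z - w \<in> boundaries K i" if "z \<in> cycles K i" "w \<in> cycles K i" for z w
  proof -
    have d: "z - w \<in> cycles K i" using that by (simp add: cycles_closed)
    have "q z = q (z - w) \<otimes>\<^bsub>?H\<^esub> q w" using add[OF d that(2)] by simp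
    moreover have "q (z - w) \<in> carrier ?H" "q w \<in> carrier ?H" using d that cH by auto
    ultimately have "q z = q w \<longleftrightarrow> q (z - w) = \<one>\<^bsub>?H\<^esub>" by (metis H.l_one H.r_cancel_one)
    then show ?thesis using one[OF d] by simp
  qed
  have "torsion_subgroup ?H = carrier ?H"
    using assms(2) betti_eq_0_iff[OF fin] homology_torsion_iff by simp
  then have "torsion_number K i = card (q ` cycles K i)" by (simp add: torsion_number_def cH)
  also have "q ` cycles K i = (q \<circ> f) ` Y"
  proof
    show "q ` cycles K i \<subseteq> (q \<circ> f) ` Y"
    proof
      fix h assume "h \<in> q ` cycles K i"
      then obtain z where z: "z \<in> cycles K i" "h = q z" by blast
      with trans obtain x where "x \<in> Y" "z - f x \<in> boundaries K i" by blast
      with z rep eq show "h \<in> (q \<circ> f) ` Y" by (auto intro!: image_eqI[of _ _ x])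
    qed
  qed (use rep in auto)
  also have "inj_on (q \<circ> f) Y"
  proof (rule inj_onI)
    fix x y assume xy: "x \<in> Y" "y \<in> Y" "(q \<circ> f) x = (q \<circ> f) y"
    then have "f x - f x \<in> boundaries K i" "f x - f y \<in> boundaries K i" using eq rep by force+
    then show "x = y" using trans[OF rep[OF xy(1)]] xy by blast
  qed
  then have "card ((q \<circ> f) ` Y) = card Y" by (rule card_image)
  finally show ?thesis .
qed

end

section \<open>Cross-polytope cycles on order ideals of index vectors\<close>

text \<open>The sets of index vectors of top-dimensional faces of color-shifted complexes, stripped of their geometry:
finite sets of positive vectors that are closed under decreasing an entry.\<close>

locale index_ideal =
  fixes Q :: "'q set" and J :: "('q \<Rightarrow> nat) set"
  assumes finite_Q: "finite Q" and finite_J: "finite J"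
    and J_PiE: "J \<subseteq> PiE Q (\<lambda>_. {1..})"
    and J_down: "\<And>j q b. j \<in> J \<Longrightarrow> q \<in> Q \<Longrightarrow> 1 \<le> b \<Longrightarrow> b \<le> j q \<Longrightarrow> j(q := b) \<in> J"
begin

definition core :: "('q \<Rightarrow> nat) set" where
  "core = {j \<in> J. \<forall>q\<in>Q. 2 \<le> j q}"

text \<open>The reduced fundamental cycle of the pair of points \<open>{a, 1}\<close>. Products of such cycles are the fundamental
cycles of cross-polytopes.\<close>

definition axis_sign :: "nat \<Rightarrow> nat \<Rightarrow> int" where
  "axis_sign a b = (if b = a then 1 else if b = 1 then -1 else 0)"

definition cross :: "('q \<Rightarrow> nat) \<Rightarrow> ('q \<Rightarrow> nat) \<Rightarrow> int" where
  "cross j r = (\<Prod>q\<in>Q. axis_sign (j q) (r q))"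

text \<open>Up to sign, this is the coefficient of the boundary of \<open>v\<close> at the ridge obtained from \<open>j\<close> by dropping \<open>q\<close>.\<close>

definition line_sum :: "(('q \<Rightarrow> nat) \<Rightarrow> int) \<Rightarrow> ('q \<Rightarrow> nat) \<Rightarrow> 'q \<Rightarrow> int" where
  "line_sum v j q = (\<Sum>b | j(q := b) \<in> J. v (j(q := b)))"

lemma core_subset: "core \<subseteq> J" and finite_core: "finite core"
  using finite_J by (auto simp: core_def)

lemma J_pos: "j \<in> J \<Longrightarrow> q \<in> Q \<Longrightarrow> 1 \<le> j q"
  using subsetD[OF J_PiE, of j] by (auto dest: PiE_mem)

lemma J_eqI: "j \<in> J \<Longrightarrow> i \<in> J \<Longrightarrow> (\<And>q. q \<in> Q \<Longrightarrow> j q = i q) \<Longrightarrow> j = i"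
  using J_PiE by (intro PiE_ext[of j Q "\<lambda>_. {1..}" i]) auto

lemma finite_line: "finite {b. j(q := b) \<in> J}"
proof (rule finite_subset)
  show "{b. j(q := b) \<in> J} \<subseteq> (\<lambda>i. i q) ` J" by (auto intro!: image_eqI[of _ _ "j(q := b)" for b])
qed (use finite_J in auto)

lemma J_below:
  assumes "j \<in> J" "r \<in> PiE Q (\<lambda>q. {1..j q})"
  shows "r \<in> J"
proof -
  have "(\<lambda>q. if q \<in> A then r q else j q) \<in> J" if "A \<subseteq> Q" for A
    using finite_subset[OF that finite_Q] that
  proof (induction A rule: finite_induct)
    case (insert q A)
    have "(\<lambda>p. if p \<in> A then r p else j p)(q := r q) \<in> J"
      using insert assms by (intro J_down) (auto simp: PiE_def Pi_def)
    also have "(\<lambda>p. if p \<in> A then r p else j p)(q := r q) = (\<lambda>p. if p \<in> insert q A then r p else j p)"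
      by auto
    finally show ?case .
  qed (use assms in auto)
  from this[OF subset_refl] have *: "(\<lambda>q. if q \<in> Q then r q else j q) \<in> J" .
  also have "(\<lambda>q. if q \<in> Q then r q else j q) = r"
    using assms J_PiE by (intro ext) (auto simp: PiE_def extensional_def)
  finally show ?thesis .
qed

lemma cross_core:
  assumes "j \<in> core" "r \<in> core"
  shows "cross j r = (if r = j then 1 else 0)"
proof (cases "r = j")
  case True then show ?thesis by (simp add: cross_def axis_sign_def)
next
  case False
  then obtain q where q: "q \<in> Q" "r q \<noteq> j q"
    using J_eqI assms by (metis (mono_tags, lifting) core_subset subsetD)
  have "2 \<le> r q" using assms q by (auto simp: core_def)
  then have "axis_sign (j q) (r q) = 0" using q by (simp add: axis_sign_def)
  then show ?thesis using False q finite_Q by (auto simp: cross_def prod_zero_iff)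
qed

text \<open>If the vector \<open>i\<close> meets the cross-polytope in the colors other than \<open>q\<close>, then the line through \<open>i\<close> in
direction \<open>q\<close> contains both of its points in that direction, because they lie below \<open>j\<close>; their signs cancel.\<close>

lemma line_sum_cross:
  assumes j: "j \<in> core" and i: "i \<in> J" and q: "q \<in> Q"
  shows "line_sum (cross j) i q = 0"
proof -
  define C where "C = (\<Prod>p\<in>Q-{q}. axis_sign (j p) (i p))"
  have "cross j (i(q := b)) = axis_sign (j q) b * C" for b
    unfolding cross_def C_def using finite_Q q by (simp add: prod.remove[of Q q])
  then have eq: "line_sum (cross j) i q = (\<Sum>b | i(q := b) \<in> J. axis_sign (j q) b) * C"
    by (simp add: line_sum_def sum_distrib_right)
  show ?thesis
  proof (cases "C = 0")
    case False
    then have "axis_sign (j p) (i p) \<noteq> 0" if "p \<in> Q - {q}" for p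
      using that finite_Q unfolding C_def by (simp add: prod_zero_iff)
    then have *: "i p = j p \<or> i p = 1" if "p \<in> Q - {q}" for p
      using that by (metis axis_sign_def)
    have J: "j \<in> J" "2 \<le> j q" using j q by (auto simp: core_def)
    have mem: "i(q := b) \<in> J" if "1 \<le> b" "b \<le> j q" for b
    proof (rule J_below[OF J(1)])
      show "i(q := b) \<in> PiE Q (\<lambda>q. {1..j q})"
      proof (rule PiE_I)
        fix p assume "p \<in> Q"
        then show "(i(q := b)) p \<in> {1..j p}"
          using that *[of p] J_pos[OF J(1), of p] by auto
      next
        fix p assume "p \<notin> Q"
        then show "(i(q := b)) p = undefined"
          using subsetD[OF J_PiE i] q by (auto simp: PiE_def extensional_def)
      qed
    qed
    have "(\<Sum>b | i(q := b) \<in> J. axis_sign (j q) b) = (\<Sum>b\<in>{1, j q}. axis_sign (j q) b)"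
      using mem J(2) by (intro sum.mono_neutral_right finite_line) (auto simp: axis_sign_def)
    also have "\<dots> = 0" using J(2) by (simp add: axis_sign_def)
    finally show ?thesis using eq by simp
  qed (simp add: eq)
qed

text \<open>A vector with some entry \<open>1\<close> is expressed, by the line through it in that direction, in terms of vectors with
fewer entries \<open>1\<close>.\<close>

lemma line_sums_zero_imp_zero:
  assumes lines: "\<And>j q. j \<in> J \<Longrightarrow> q \<in> Q \<Longrightarrow> line_sum v j q = 0"
    and zero: "\<And>j. j \<in> core \<Longrightarrow> v j = 0" and "j \<in> J"
  shows "v j = 0"
  using \<open>j \<in> J\<close>
proof (induction "card {q \<in> Q. j q = 1}" arbitrary: j rule: less_induct)
  case less
  show ?case
  proof (cases "\<exists>q\<in>Q. j q = 1")
    case False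
    then have "j \<in> core" using less.prems J_pos[OF less.prems] by (fastforce simp: core_def)
    then show ?thesis by (rule zero)
  next
    case True
    then obtain q where q: "q \<in> Q" "j q = 1" by blast
    have "v (j(q := b)) = 0" if b: "j(q := b) \<in> J" "b \<noteq> 1" for b
    proof (rule less.hyps[OF _ b(1)])
      have "{p \<in> Q. (j(q := b)) p = 1} \<subset> {p \<in> Q. j p = 1}" using q b by auto
      then show "card {p \<in> Q. (j(q := b)) p = 1} < card {p \<in> Q. j p = 1}"
        using finite_Q by (intro psubset_card_mono) auto
    qed
    then have "line_sum v j q = (\<Sum>b\<in>{1}. v (j(q := b)))"
      unfolding line_sum_def using q less.prems
      by (intro sum.mono_neutral_right finite_line) (auto simp: fun_upd_idem)
    then show ?thesis using lines[OF less.prems q(1)] q by (simp add: fun_upd_idem)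
  qed
qed

text \<open>The cross-polytope cycles form a basis of the cycles: subtracting the combination with the coefficients that
\<open>v\<close> takes on the core leaves a cycle that vanishes there.\<close>

lemma line_sums_zero_iff:
  "(\<forall>j\<in>J. \<forall>q\<in>Q. line_sum v j q = 0) \<longleftrightarrow>
     (\<exists>a. \<forall>r\<in>J. v r = (\<Sum>j\<in>core. a j * cross j r))"
proof
  assume lines: "\<forall>j\<in>J. \<forall>q\<in>Q. line_sum v j q = 0"
  define w where "w r = v r - (\<Sum>j\<in>core. v j * cross j r)" for r
  have "w r = 0" if "r \<in> J" for r
  proof (rule line_sums_zero_imp_zero[OF _ _ that])
    fix j q assume jq: "j \<in> J" "q \<in> Q"
    have "line_sum w j q = line_sum v j q - (\<Sum>i\<in>core. v i * line_sum (cross i) j q)"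
      unfolding line_sum_def w_def sum_subtractf sum_distrib_left by (subst sum.swap) simp
    then show "line_sum w j q = 0" using lines jq by (simp add: line_sum_cross)
  next
    fix j assume j: "j \<in> core"
    have "(\<Sum>i\<in>core. v i * cross i j) = (\<Sum>i\<in>core. if i = j then v i else 0)"
      using j by (intro sum.cong) (auto simp: cross_core)
    then show "w j = 0" using j finite_core by (simp add: w_def)
  qed
  then show "\<exists>a. \<forall>r\<in>J. v r = (\<Sum>j\<in>core. a j * cross j r)"
    by (intro exI[of _ v]) (simp add: w_def)
next
  assume "\<exists>a. \<forall>r\<in>J. v r = (\<Sum>j\<in>core. a j * cross j r)"
  then obtain a where a: "\<And>r. r \<in> J \<Longrightarrow> v r = (\<Sum>j\<in>core. a j * cross j r)" by blast
  show "\<forall>j\<in>J. \<forall>q\<in>Q. line_sum v j q = 0"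
  proof (intro ballI)
    fix j q assume jq: "j \<in> J" "q \<in> Q"
    have "line_sum v j q = (\<Sum>b | j(q := b) \<in> J. \<Sum>i\<in>core. a i * cross i (j(q := b)))"
      unfolding line_sum_def by (intro sum.cong) (auto simp: a)
    also have "\<dots> = (\<Sum>i\<in>core. a i * line_sum (cross i) j q)"
      unfolding line_sum_def sum_distrib_left by (rule sum.swap)
    finally show "line_sum v j q = 0" using jq by (simp add: line_sum_cross)
  qed
qed

end

section \<open>Vanishing of codimension-one homology\<close>

locale color_shifted_complex =
  fixes d :: nat and n :: "nat \<Rightarrow> nat" and K :: "vertex set set"
  assumes shifted: "color_shifted d n K"
begin

abbreviation colors :: "nat set" where "colors \<equiv> {1..d + 1}"

definition cells :: "(nat \<Rightarrow> nat) set" where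
  "cells = {j \<in> PiE colors (\<lambda>_. UNIV). rainbow_face d j \<in> K}"

lemma K_props:
  shows finite_V: "finite (\<Union>q\<in>colors. color_class n q)"
    and K_V: "K \<subseteq> Pow (\<Union>q\<in>colors. color_class n q)"
    and K_ne: "K \<noteq> {}"
    and K_down: "\<forall>\<sigma>\<in>K. \<forall>\<tau>. \<tau> \<subseteq> \<sigma> \<longrightarrow> \<tau> \<in> K"
    and K_facets: "\<forall>\<sigma>\<in>facets K. \<forall>q\<in>colors. card (\<sigma> \<inter> color_class n q) = 1"
    and K_shift: "\<sigma> \<in> K \<Longrightarrow> Vert q j \<in> \<sigma> \<Longrightarrow> 1 \<le> j' \<Longrightarrow> j' < j \<Longrightarrow> (\<sigma> - {Vert q j}) \<union> {Vert q j'} \<in> K"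
  using shifted by (auto simp: color_shifted_def simplicial_complex_on_def)

lemma finite_K: "finite K"
  using K_V finite_V by (meson finite_Pow_iff finite_subset)

lemma finite_face: "\<sigma> \<in> K \<Longrightarrow> finite \<sigma>"
  using K_V finite_V by (meson PowD finite_subset subsetD)

lemma finite_faces: "finite (faces K i)"
  using finite_K by (simp add: faces_def)

lemma vertex_props:
  assumes "\<sigma> \<in> K" "v \<in> \<sigma>"
  shows "color v \<in> colors" "1 \<le> idx v" "v \<in> color_class n (color v)"
proof -
  obtain q where "q \<in> colors" "v \<in> color_class n q" using K_V assms by blast
  then show "color v \<in> colors" "1 \<le> idx v" "v \<in> color_class n (color v)"
    by (auto simp: color_class_def)
qed

lemma facet_above:
  assumes "\<sigma> \<in> K" obtains \<phi> where "\<phi> \<in> facets K" "\<sigma> \<subseteq> \<phi>"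
proof -
  obtain \<phi> where "\<phi> \<in> K" "\<sigma> \<subseteq> \<phi>" "\<And>\<tau>. \<tau> \<in> K \<Longrightarrow> \<phi> \<subseteq> \<tau> \<Longrightarrow> \<phi> = \<tau>"
    using finite_has_maximal2[OF finite_K assms] by metis
  then show ?thesis by (intro that[of \<phi>]) (auto simp: facets_def)
qed

lemma inj_on_color:
  assumes "\<sigma> \<in> K" shows "inj_on color \<sigma>"
proof (rule inj_onI)
  fix v w assume vw: "v \<in> \<sigma>" "w \<in> \<sigma>" "color v = color w"
  obtain \<phi> where f: "\<phi> \<in> facets K" "\<sigma> \<subseteq> \<phi>" using facet_above[OF assms] .
  have "color v \<in> colors" using vertex_props assms vw by blast
  then have "card (\<phi> \<inter> color_class n (color v)) = 1" using K_facets f by blast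
  moreover have "v \<in> \<phi> \<inter> color_class n (color v)" "w \<in> \<phi> \<inter> color_class n (color v)"
    using vertex_props[OF assms] vw f by force+
  ultimately show "v = w" by (metis card_1_singletonE singletonD)
qed

lemma card_face: "\<sigma> \<in> K \<Longrightarrow> card \<sigma> = card (color ` \<sigma>)"
  by (simp add: card_image inj_on_color)

lemma color_face_subset: "\<sigma> \<in> K \<Longrightarrow> color ` \<sigma> \<subseteq> colors"
  using vertex_props by blast

lemma card_face_le: "\<sigma> \<in> K \<Longrightarrow> card \<sigma> \<le> d + 1"
  using card_mono[OF _ color_face_subset, of \<sigma>] card_face by simp

text \<open>By purity a face without color \<open>q\<close> extends by some vertex of that color, and shifting makes it the first one.
This is what makes coning with the first vertex possible inside the complex.\<close>

lemma insert_first_vertex: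
  assumes s: "\<sigma> \<in> K" and q: "q \<in> colors" "q \<notin> color ` \<sigma>"
  shows "insert (Vert q 1) \<sigma> \<in> K"
proof -
  obtain \<phi> where f: "\<phi> \<in> facets K" "\<sigma> \<subseteq> \<phi>" using facet_above[OF s] .
  then have fK: "\<phi> \<in> K" by (simp add: facets_def)
  have "card (\<phi> \<inter> color_class n q) = 1" using K_facets f q by blast
  then obtain v where v: "v \<in> \<phi>" "v \<in> color_class n q" by (metis card_1_singletonE IntE insertI1)
  then obtain j where j: "v = Vert q j" "1 \<le> j" by (auto simp: color_class_def)
  have "insert (Vert q 1) (\<phi> - {v}) \<in> K"
  proof (cases "j = 1")
    case True then show ?thesis using v j fK by (simp add: insert_absorb insert_Diff)
  next
    case False then show ?thesis using K_shift[OF fK, of q j 1] v j by simp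
  qed
  moreover have "insert (Vert q 1) \<sigma> \<subseteq> insert (Vert q 1) (\<phi> - {v})"
    using f q j by force
  ultimately show ?thesis using K_down by blast
qed

text \<open>The cone with apex \<open>v(q,1)\<close>, defined to be zero on faces that already have color \<open>q\<close>, since their cone need not lie
in the complex. The defect measures by how much coning fails to be a contracting homotopy.\<close>

definition cone_face :: "nat \<Rightarrow> vertex set \<Rightarrow> vertex set \<Rightarrow>\<^sub>0 int" where
  "cone_face q \<sigma> = (if q \<in> color ` \<sigma> then 0
     else frag_cmul (removal_sign (Vert q 1) \<sigma>) (frag_of (insert (Vert q 1) \<sigma>)))"

abbreviation cone :: "nat \<Rightarrow> (vertex set \<Rightarrow>\<^sub>0 int) \<Rightarrow> vertex set \<Rightarrow>\<^sub>0 int" where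
  "cone q \<equiv> frag_extend (cone_face q)"

definition cone_defect :: "nat \<Rightarrow> vertex set \<Rightarrow> vertex set \<Rightarrow>\<^sub>0 int" where
  "cone_defect q \<sigma> = frag_of \<sigma> - boundary_map (cone_face q \<sigma>) - cone q (face_boundary \<sigma>)"

lemma removal_sign_insert: "removal_sign v (insert v \<sigma>) = removal_sign v \<sigma>"
proof -
  have "{w \<in> insert v \<sigma>. w < v} = {w \<in> \<sigma>. w < v}" by auto
  then show ?thesis by (simp add: removal_sign_def)
qed

lemma cone_face_boundary:
  "finite \<sigma> \<Longrightarrow> cone q (face_boundary \<sigma>) =
     (\<Sum>w\<in>\<sigma>. frag_cmul (removal_sign w \<sigma>) (cone_face q (\<sigma> - {w})))"
  unfolding face_boundary_alt by (simp add: frag_extend_sum frag_extend_cmul o_def)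

lemma cone_defect_missing:
  assumes "finite \<sigma>" "q \<notin> color ` \<sigma>"
  shows "cone_defect q \<sigma> = 0"
proof -
  define v where "v = Vert q 1"
  define \<sigma>' where "\<sigma>' = insert v \<sigma>"
  have v: "v \<notin> \<sigma>" using assms by (force simp: v_def)
  have sgn: "removal_sign v \<sigma> * removal_sign w \<sigma>' =
      - (removal_sign w \<sigma> * removal_sign v (\<sigma> - {w}))" if w: "w \<in> \<sigma>" for w
  proof -
    have "v \<noteq> w" using v w by blast
    have "removal_sign v \<sigma>' * removal_sign w (\<sigma>' - {v}) =
         - (removal_sign w \<sigma>' * removal_sign v (\<sigma>' - {w}))"
      using assms \<open>v \<noteq> w\<close> w by (intro removal_sign_swap) (auto simp: \<sigma>'_def)
    moreover have "\<sigma>' - {v} = \<sigma>" "\<sigma>' - {w} = insert v (\<sigma> - {w})" using v w by (auto simp: \<sigma>'_def)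
    ultimately have pr: "removal_sign v \<sigma> * removal_sign w \<sigma> = - (removal_sign w \<sigma>' * removal_sign v (\<sigma> - {w}))"
      by (simp add: removal_sign_insert \<sigma>'_def)
    have alg: "b * e = - (a * c)" if "a * b = - (c * e)" "a * a = 1" "e * e = 1" for a b c e :: int
    proof -
      have "b * e = (a * a) * (b * e)" using that(2) by simp
      also have "\<dots> = (a * b) * (a * e)" by (simp only: mult_ac)
      also have "\<dots> = - (a * c) * (e * e)" unfolding that(1) by (simp add: mult_ac)
      finally show ?thesis using that(3) by simp
    qed
    from alg[OF pr removal_sign_squared removal_sign_squared] show ?thesis by simp
  qed
  have "boundary_map (cone_face q \<sigma>) = frag_cmul (removal_sign v \<sigma>) (face_boundary \<sigma>')"
    using assms by (simp add: cone_face_def v_def \<sigma>'_def boundary_map_simps)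
  also have "face_boundary \<sigma>' = frag_cmul (removal_sign v \<sigma>) (frag_of \<sigma>) +
      (\<Sum>w\<in>\<sigma>. frag_cmul (removal_sign w \<sigma>') (frag_of (\<sigma>' - {w})))"
    unfolding face_boundary_alt using assms v by (simp add: \<sigma>'_def removal_sign_insert)
  finally have 1: "boundary_map (cone_face q \<sigma>) = frag_of \<sigma> +
      (\<Sum>w\<in>\<sigma>. frag_cmul (removal_sign v \<sigma> * removal_sign w \<sigma>') (frag_of (\<sigma>' - {w})))"
    by (simp add: frag_cmul_distrib2 frag_cmul_sum)
  have "cone q (face_boundary \<sigma>) =
     (\<Sum>w\<in>\<sigma>. frag_cmul (removal_sign w \<sigma> * removal_sign v (\<sigma> - {w})) (frag_of (insert v (\<sigma> - {w}))))"
    unfolding cone_face_boundary[OF assms(1)]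
    using assms by (intro sum.cong) (auto simp: cone_face_def v_def)
  also have "\<dots> = (\<Sum>w\<in>\<sigma>. - frag_cmul (removal_sign v \<sigma> * removal_sign w \<sigma>') (frag_of (\<sigma>' - {w})))"
  proof (rule sum.cong[OF refl])
    fix w assume w: "w \<in> \<sigma>"
    have "insert v (\<sigma> - {w}) = \<sigma>' - {w}" using v w by (auto simp: \<sigma>'_def)
    then show "frag_cmul (removal_sign w \<sigma> * removal_sign v (\<sigma> - {w})) (frag_of (insert v (\<sigma> - {w}))) =
       - frag_cmul (removal_sign v \<sigma> * removal_sign w \<sigma>') (frag_of (\<sigma>' - {w}))"
      using sgn[OF w] by simp
  qed
  also have "\<dots> = - (\<Sum>w\<in>\<sigma>. frag_cmul (removal_sign v \<sigma> * removal_sign w \<sigma>') (frag_of (\<sigma>' - {w})))"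
    by (rule sum_negf)
  finally show ?thesis unfolding cone_defect_def 1 by simp
qed

text \<open>On a face without color \<open>q\<close> the cone is a contracting homotopy, so there is no defect. On a face with
that color the defect consists of the face itself and of the face with its vertex of color \<open>q\<close> replaced by the
first one. Hence replacing a cycle by its defect, which changes it by a boundary, forces color \<open>q\<close> upon its
faces and keeps all colors that they had.\<close>

lemma keys_cone_defect:
  assumes s: "\<sigma> \<in> K" and q: "q \<in> colors"
  shows "Poly_Mapping.keys (cone_defect q \<sigma>) \<subseteq>
     {\<tau> \<in> K. card \<tau> = card \<sigma> \<and> insert q (color ` \<sigma>) \<subseteq> color ` \<tau>}"
proof (cases "q \<in> color ` \<sigma>")
  case False
  then show ?thesis using cone_defect_missing[OF finite_face[OF s]] by simp
next
  case True
  then obtain u where u: "u \<in> \<sigma>" "q = color u" by blast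
  have fin: "finite \<sigma>" using s by (rule finite_face)
  have only: "w = u" if "w \<in> \<sigma>" "color w = q" for w
    using inj_on_color[OF s] that u by (auto simp: inj_on_def)
  have miss: "q \<notin> color ` (\<sigma> - {u})" using only by auto
  have "cone q (face_boundary \<sigma>) = (\<Sum>w\<in>{u}. frag_cmul (removal_sign w \<sigma>) (cone_face q (\<sigma> - {w})))"
    unfolding cone_face_boundary[OF fin] using fin u
    by (intro sum.mono_neutral_right) (auto simp: cone_face_def)
  then have eq: "cone_defect q \<sigma> = frag_of \<sigma> - frag_cmul (removal_sign u \<sigma>)
      (frag_cmul (removal_sign (Vert q 1) (\<sigma> - {u})) (frag_of (insert (Vert q 1) (\<sigma> - {u}))))"
    using True miss by (simp add: cone_defect_def cone_face_def boundary_map_simps)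
  have "Poly_Mapping.keys (cone_defect q \<sigma>) \<subseteq> {\<sigma>, insert (Vert q 1) (\<sigma> - {u})}"
    unfolding eq
    by (rule order_trans[OF keys_diff])
       (auto simp: keys_frag_of)
  moreover have mem: "insert (Vert q 1) (\<sigma> - {u}) \<in> K"
    using K_down s by (intro insert_first_vertex q miss) blast
  moreover have "color ` insert (Vert q 1) (\<sigma> - {u}) = color ` \<sigma>"
  proof -
    have "\<sigma> = insert u (\<sigma> - {u})" using u(1) by blast
    then have "color ` \<sigma> = insert q (color ` (\<sigma> - {u}))" using u(2) by (metis image_insert)
    then show ?thesis by simp
  qed
  moreover have "card (insert (Vert q 1) (\<sigma> - {u})) = card \<sigma>"
    using calculation(3) card_face mem s by simp
  ultimately show ?thesis using s True by auto
qed

lemma faces_iff: "\<sigma> \<in> faces K (int k - 1) \<longleftrightarrow> \<sigma> \<in> K \<and> card \<sigma> = k"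
  by (auto simp: faces_def face_dim_def)

lemma cone_defect_extend:
  "frag_extend (cone_defect q) z = z - boundary_map (cone q z) - cone q (boundary_map z)"
  using subset_UNIV
proof (induction z rule: frag_induction)
  case (one \<sigma>)
  show ?case by (simp add: cone_defect_def boundary_map_simps)
next
  case (diff a b)
  then show ?case by (simp add: frag_extend_diff boundary_map_simps)
qed (auto simp: boundary_map_simps)

text \<open>After the defect has been taken for every color, all faces in the support would have all \<open>d + 1\<close> colors, which is
impossible for faces with \<open>d\<close> vertices; so only boundaries have been subtracted and nothing is left.\<close>

lemma codim1_cycle_is_boundary:
  assumes z: "z \<in> cycles K (int d - 1)"
  shows "\<exists>w. Poly_Mapping.keys w \<subseteq> faces K (int d) \<and> boundary_map w = z"
proof -
  have step: "\<exists>w z'. Poly_Mapping.keys w \<subseteq> faces K (int d) \<and> z = z' + boundary_map w \<and>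
      Poly_Mapping.keys z' \<subseteq> {\<tau> \<in> K. card \<tau> = d \<and> A \<subseteq> color ` \<tau>}" if "A \<subseteq> colors" for A
    using finite_subset[OF that finite_atLeastAtMost] that
  proof (induction A rule: finite_induct)
    case empty
    show ?case using z
      by (intro exI[of _ 0] exI[of _ z]) (auto simp: cycles_def chain_grp_def boundary_map_simps faces_iff)
  next
    case (insert q A)
    then obtain w z' where wz: "Poly_Mapping.keys w \<subseteq> faces K (int d)" "z = z' + boundary_map w"
      "Poly_Mapping.keys z' \<subseteq> {\<tau> \<in> K. card \<tau> = d \<and> A \<subseteq> color ` \<tau>}" by auto
    have "boundary_map z = 0" using z by (simp add: cycles_def)
    then have cyc: "boundary_map z' = 0" using wz(2) by (simp add: boundary_map_simps boundary_boundary)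
    define z'' where "z'' = frag_extend (cone_defect q) z'"
    have "z' = z'' + boundary_map (cone q z')"
      unfolding z''_def cone_defect_extend cyc by simp
    then have "z = z'' + boundary_map (cone q z' + w)"
      using wz(2) by (simp add: boundary_map_simps)
    moreover have "Poly_Mapping.keys z'' \<subseteq> {\<tau> \<in> K. card \<tau> = d \<and> insert q A \<subseteq> color ` \<tau>}"
    proof
      fix \<tau> assume "\<tau> \<in> Poly_Mapping.keys z''"
      then obtain \<sigma> where s: "\<sigma> \<in> Poly_Mapping.keys z'" "\<tau> \<in> Poly_Mapping.keys (cone_defect q \<sigma>)"
        unfolding z''_def using keys_frag_extend[of "cone_defect q" z'] by blast
      then have "\<sigma> \<in> K" "card \<sigma> = d" "A \<subseteq> color ` \<sigma>" using wz(3) by auto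
      moreover have "\<tau> \<in> {\<tau> \<in> K. card \<tau> = card \<sigma> \<and> insert q (color ` \<sigma>) \<subseteq> color ` \<tau>}"
        by (rule subsetD[OF keys_cone_defect s(2)]) (use \<open>\<sigma> \<in> K\<close> insert.prems in auto)
      ultimately show "\<tau> \<in> {\<tau> \<in> K. card \<tau> = d \<and> insert q A \<subseteq> color ` \<tau>}" by auto
    qed
    moreover have "Poly_Mapping.keys (cone q z') \<subseteq> faces K (int d)"
    proof
      fix \<tau> assume "\<tau> \<in> Poly_Mapping.keys (cone q z')"
      then obtain \<sigma> where s: "\<sigma> \<in> Poly_Mapping.keys z'" "\<tau> \<in> Poly_Mapping.keys (cone_face q \<sigma>)"
        using keys_frag_extend[of "cone_face q" z'] by blast
      then have sK: "\<sigma> \<in> K" "card \<sigma> = d" using wz(3) by auto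
      from s have q: "q \<notin> color ` \<sigma>" and t: "\<tau> = insert (Vert q 1) \<sigma>"
        by (auto simp: cone_face_def split: if_splits)
      have "Vert q 1 \<notin> \<sigma>" using q by force
      moreover have "insert (Vert q 1) \<sigma> \<in> K"
        by (rule insert_first_vertex) (use sK q insert.prems in auto)
      ultimately show "\<tau> \<in> faces K (int d)"
        using sK t finite_face by (simp add: faces_def face_dim_def)
    qed
    then have "Poly_Mapping.keys (cone q z' + w) \<subseteq> faces K (int d)"
      using keys_add[of "cone q z'" w] wz(1) by blast
    ultimately show ?case by blast
  qed
  from step[OF subset_refl] obtain w z' where wz: "Poly_Mapping.keys w \<subseteq> faces K (int d)"
    "z = z' + boundary_map w" "Poly_Mapping.keys z' \<subseteq> {\<tau> \<in> K. card \<tau> = d \<and> colors \<subseteq> color ` \<tau>}"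
    by blast
  have "Poly_Mapping.keys z' = {}"
  proof (rule ccontr)
    assume "Poly_Mapping.keys z' \<noteq> {}"
    then obtain \<tau> where t: "\<tau> \<in> K" "card \<tau> = d" "colors \<subseteq> color ` \<tau>" using wz(3) by blast
    then have "card colors \<le> card (color ` \<tau>)" by (intro card_mono) (auto simp: finite_face)
    then show False using t card_face[of \<tau>] by simp
  qed
  then have "z' = 0" by simp
  then show ?thesis using wz by auto
qed

end

section \<open>Chains of top-dimensional faces in coordinates\<close>

context color_shifted_complex
begin

lemma rainbow_face_image: "rainbow_face d j = (\<lambda>q. Vert q (j q)) ` colors"
  by (auto simp: rainbow_face_def)

lemma rainbow_face_eq_iff: "rainbow_face d i = rainbow_face d j \<longleftrightarrow> (\<forall>q\<in>colors. i q = j q)"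
proof
  assume eq: "rainbow_face d i = rainbow_face d j"
  show "\<forall>q\<in>colors. i q = j q"
  proof
    fix q assume "q \<in> colors"
    then have "Vert q (i q) \<in> rainbow_face d i" by (auto simp: rainbow_face_image)
    then show "i q = j q" unfolding eq by (auto simp: rainbow_face_image)
  qed
qed (unfold rainbow_face_image, intro image_cong, auto)

lemma cells_shift:
  assumes "j \<in> cells" "q \<in> colors" "1 \<le> b" "b \<le> j q"
  shows "j(q := b) \<in> cells"
proof (cases "b = j q")
  case False
  have K: "rainbow_face d j \<in> K" and ext: "j \<in> PiE colors (\<lambda>_. UNIV)" using assms by (auto simp: cells_def)
  have "Vert q (j q) \<in> rainbow_face d j" using assms by (auto simp: rainbow_face_image)
  from K_shift[OF K this, of b] have "rainbow_face d j - {Vert q (j q)} \<union> {Vert q b} \<in> K"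
    using assms False by auto
  also have "rainbow_face d j - {Vert q (j q)} \<union> {Vert q b} = rainbow_face d (j(q := b))"
    using assms by (auto simp: rainbow_face_image)
  finally show ?thesis using ext assms by (auto simp: cells_def PiE_def extensional_def)
qed (use assms in simp)

lemma inj_on_rainbow: "inj_on (rainbow_face d) cells"
proof (rule inj_onI)
  fix i j assume "i \<in> cells" "j \<in> cells" "rainbow_face d i = rainbow_face d j"
  then show "i = j" unfolding rainbow_face_eq_iff by (auto simp: cells_def intro: PiE_ext)
qed

sublocale index_ideal colors cells
proof
  have "rainbow_face d ` cells \<subseteq> K" by (auto simp: cells_def)
  then show "finite cells" using inj_on_rainbow finite_K by (metis finite_imageD finite_subset)
  show "cells \<subseteq> PiE colors (\<lambda>_. {1..})"
  proof
    fix j assume j: "j \<in> cells"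
    have "1 \<le> j q" if "q \<in> colors" for q
      using vertex_props(2)[of "rainbow_face d j" "Vert q (j q)"] j that
      by (auto simp: cells_def rainbow_face_image)
    then show "j \<in> PiE colors (\<lambda>_. {1..})" using j by (auto simp: cells_def PiE_def)
  qed
qed (use cells_shift in auto)

lemma card_rainbow: "card (rainbow_face d j) = d + 1"
  unfolding rainbow_face_image by (subst card_image) (auto simp: inj_on_def)

lemma top_face_is_rainbow:
  assumes "\<sigma> \<in> K" "card \<sigma> = d + 1"
  shows "\<sigma> \<in> rainbow_face d ` cells"
proof -
  have fin: "finite colors" by simp
  have "card (color ` \<sigma>) = card colors" using assms card_face by simp
  then have col: "color ` \<sigma> = colors"
    using card_subset_eq[OF fin color_face_subset[OF assms(1)]] by simp
  define j where "j = restrict (\<lambda>q. idx (inv_into \<sigma> color q)) colors"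
  have v: "Vert q (j q) = inv_into \<sigma> color q" if "q \<in> colors" for q
  proof -
    have "color (inv_into \<sigma> color q) = q" using that col by (simp add: f_inv_into_f)
    then show ?thesis using that by (cases "inv_into \<sigma> color q") (simp add: j_def)
  qed
  have "rainbow_face d j = inv_into \<sigma> color ` colors" unfolding rainbow_face_image using v by (rule image_cong[OF refl])
  also have "\<dots> = \<sigma>" unfolding col[symmetric] using inj_on_color[OF assms(1)] by simp
  finally have "rainbow_face d j = \<sigma>" .
  moreover have "j \<in> PiE colors (\<lambda>_. UNIV)" by (simp add: j_def)
  ultimately have "j \<in> cells" using assms(1) by (simp add: cells_def)
  then show ?thesis using \<open>rainbow_face d j = \<sigma>\<close> by blast
qed

lemma top_faces: "faces K (int d) = rainbow_face d ` cells"
  using top_face_is_rainbow by (auto simp: faces_def face_dim_def card_rainbow cells_def)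

definition ridge :: "(nat \<Rightarrow> nat) \<Rightarrow> nat \<Rightarrow> vertex set" where
  "ridge j q = rainbow_face d j - {Vert q (j q)}"

lemma ridge_image: "ridge j q = (\<lambda>p. Vert p (j p)) ` (colors - {q})"
  by (auto simp: ridge_def rainbow_face_image)

lemma ridge_eq_iff:
  assumes "q \<in> colors" "p \<in> colors"
  shows "ridge i q = ridge j p \<longleftrightarrow> q = p \<and> (\<forall>r\<in>colors-{p}. i r = j r)"
proof
  assume eq: "ridge i q = ridge j p"
  then have "color ` ridge i q = color ` ridge j p" by simp
  then have "colors - {q} = colors - {p}" by (simp add: ridge_image image_image)
  then have "q = p" using assms by blast
  moreover have "i r = j r" if "r \<in> colors - {p}" for r
  proof -
    have "Vert r (i r) \<in> ridge j p" using eq that \<open>q = p\<close> by (metis (mono_tags, lifting) image_eqI ridge_image)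
    then show ?thesis by (auto simp: ridge_image)
  qed
  ultimately show "q = p \<and> (\<forall>r\<in>colors-{p}. i r = j r)" by blast
qed (auto simp: ridge_image)

text \<open>The vertex order sorts by color, so all top-dimensional faces carry the same signs. This is why lines
of faces have plain sums, without signs, in the boundary.\<close>

lemma face_boundary_rainbow:
  "face_boundary (rainbow_face d j) = (\<Sum>q\<in>colors. frag_cmul ((-1) ^ (q - 1)) (frag_of (ridge j q)))"
proof -
  have inj: "inj_on (\<lambda>q. Vert q (j q)) A" for A by (auto simp: inj_on_def)
  have sgn: "removal_sign (Vert q (j q)) (rainbow_face d j) = (-1) ^ (q - 1)" if "q \<in> colors" for q
  proof -
    have "{w \<in> rainbow_face d j. w < Vert q (j q)} = (\<lambda>p. Vert p (j p)) ` {1..<q}"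
      using that by (auto simp: rainbow_face_image less_vertex_def)
    then show ?thesis by (simp add: removal_sign_def card_image[OF inj])
  qed
  have "(\<Sum>v\<in>rainbow_face d j. f v) = (\<Sum>q\<in>colors. f (Vert q (j q)))" for f :: "vertex \<Rightarrow> vertex set \<Rightarrow>\<^sub>0 int"
    unfolding rainbow_face_image by (simp only: sum.reindex[OF inj] o_def)
  then show ?thesis
    unfolding face_boundary_alt ridge_def by (simp add: sgn)
qed

definition top_chain :: "((nat \<Rightarrow> nat) \<Rightarrow> int) \<Rightarrow> vertex set \<Rightarrow>\<^sub>0 int" where
  "top_chain v = (\<Sum>j\<in>cells. frag_cmul (v j) (frag_of (rainbow_face d j)))"

lemma lookup_top_chain:
  assumes "j \<in> cells" shows "Poly_Mapping.lookup (top_chain v) (rainbow_face d j) = v j"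
proof -
  have "Poly_Mapping.lookup (top_chain v) (rainbow_face d j) = (\<Sum>i\<in>cells. if i = j then v i else 0)"
    unfolding top_chain_def Poly_Mapping.lookup_sum
    using inj_on_rainbow assms by (intro sum.cong) (auto simp: inj_on_def)
  then show ?thesis using assms finite_J by simp
qed

lemma keys_top_chain: "Poly_Mapping.keys (top_chain v) \<subseteq> rainbow_face d ` {j \<in> cells. v j \<noteq> 0}"
proof
  fix \<tau> assume "\<tau> \<in> Poly_Mapping.keys (top_chain v)"
  then obtain j where "j \<in> cells" "\<tau> \<in> Poly_Mapping.keys (frag_cmul (v j) (frag_of (rainbow_face d j)))"
    unfolding top_chain_def using keys_sum[of "\<lambda>j. frag_cmul (v j) (frag_of (rainbow_face d j))" cells] by blast
  then show "\<tau> \<in> rainbow_face d ` {j \<in> cells. v j \<noteq> 0}" by (auto simp: keys_frag_of)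
qed

lemma top_chain_of_keys:
  assumes "Poly_Mapping.keys c \<subseteq> faces K (int d)"
  shows "c = top_chain (\<lambda>j. Poly_Mapping.lookup c (rainbow_face d j))"
proof (rule poly_mapping_eqI)
  fix \<tau>
  show "Poly_Mapping.lookup c \<tau> = Poly_Mapping.lookup (top_chain (\<lambda>j. Poly_Mapping.lookup c (rainbow_face d j))) \<tau>"
  proof (cases "\<tau> \<in> faces K (int d)")
    case True
    then show ?thesis by (auto simp: top_faces lookup_top_chain)
  next
    case False
    then have "\<tau> \<notin> Poly_Mapping.keys c" using assms by blast
    moreover have "\<tau> \<notin> Poly_Mapping.keys (top_chain v)" for v
      using False keys_top_chain[of v] unfolding top_faces by blast
    ultimately show ?thesis by (simp add: in_keys_iff)
  qed
qed

lemma top_chain_diff: "top_chain (\<lambda>j. u j - v j) = top_chain u - top_chain v"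
  unfolding top_chain_def by (simp add: frag_cmul_diff_distrib sum_subtractf)

lemma top_chain_scale: "top_chain (\<lambda>j. k * v j) = frag_cmul k (top_chain v)"
  unfolding top_chain_def by (simp add: frag_cmul_sum)

lemma lookup_boundary_top_chain:
  "Poly_Mapping.lookup (boundary_map (top_chain v)) \<pi> =
     (\<Sum>j\<in>cells. v j * (\<Sum>q\<in>colors. (-1) ^ (q - 1) * (if ridge j q = \<pi> then 1 else 0)))"
proof -
  have comm: "(if ridge j q = \<pi> then 1 else 0) = (if \<pi> = ridge j q then 1 else (0::int))" for j q
    by auto
  show ?thesis
    unfolding top_chain_def boundary_map_sum boundary_map_simps face_boundary_rainbow comm
    by (simp only: Poly_Mapping.lookup_sum lookup_frag_cmul lookup_frag_of)
qed

lemma line_sum_eq: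
  assumes "j \<in> cells" "q \<in> colors"
  shows "line_sum v j q = (\<Sum>i | i \<in> cells \<and> (\<forall>r\<in>colors-{q}. i r = j r). v i)"
  unfolding line_sum_def
proof (rule sum.reindex_bij_witness[of _ "\<lambda>i. i q" "\<lambda>b. j(q := b)"])
  fix i assume i: "i \<in> {i. i \<in> cells \<and> (\<forall>r\<in>colors-{q}. i r = j r)}"
  show eq: "j(q := i q) = i"
  proof
    fix r show "(j(q := i q)) r = i r"
      using i subsetD[OF J_PiE, of i] subsetD[OF J_PiE assms(1)]
      by (cases "r \<in> colors") (auto simp: PiE_def extensional_def)
  qed
  then show "i q \<in> {b. j(q := b) \<in> cells}" using i by simp
qed auto

lemma boundary_top_chain_eq_0_iff:
  "boundary_map (top_chain v) = 0 \<longleftrightarrow> (\<forall>j\<in>cells. \<forall>q\<in>colors. line_sum v j q = 0)"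
proof -
  have lk: "Poly_Mapping.lookup (boundary_map (top_chain v)) (ridge j q) = (-1) ^ (q - 1) * line_sum v j q"
    if jq: "j \<in> cells" "q \<in> colors" for j q
  proof -
    have "(\<Sum>p\<in>colors. (-1) ^ (p - 1) * (if ridge i p = ridge j q then 1 else 0)) =
        (if \<forall>r\<in>colors-{q}. i r = j r then (-1) ^ (q - 1) else (0::int))" for i
    proof -
      have "(\<Sum>p\<in>colors. (-1) ^ (p - 1) * (if ridge i p = ridge j q then 1 else 0)) =
          (\<Sum>p\<in>colors. if p = q then (if \<forall>r\<in>colors-{q}. i r = j r then (-1) ^ (q - 1) else 0) else (0::int))"
        using jq(2) by (intro sum.cong refl) (auto simp: ridge_eq_iff)
      then show ?thesis using jq(2) by simp
    qed
    then have "Poly_Mapping.lookup (boundary_map (top_chain v)) (ridge j q) =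
        (\<Sum>i\<in>cells. if \<forall>r\<in>colors-{q}. i r = j r then (-1) ^ (q - 1) * v i else 0)"
      unfolding lookup_boundary_top_chain by (intro sum.cong) (auto simp: mult.commute)
    also have "\<dots> = (\<Sum>i | i \<in> cells \<and> (\<forall>r\<in>colors-{q}. i r = j r). (-1) ^ (q - 1) * v i)"
      by (rule sum.inter_filter[OF finite_J, symmetric])
    also have "\<dots> = (-1) ^ (q - 1) * line_sum v j q"
      unfolding line_sum_eq[OF jq] sum_distrib_left ..
    finally show ?thesis .
  qed
  show ?thesis
  proof
    assume "boundary_map (top_chain v) = 0"
    then show "\<forall>j\<in>cells. \<forall>q\<in>colors. line_sum v j q = 0" using lk by auto
  next
    assume lines: "\<forall>j\<in>cells. \<forall>q\<in>colors. line_sum v j q = 0"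
    show "boundary_map (top_chain v) = 0"
    proof (rule poly_mapping_eqI)
      fix \<pi>
      show "Poly_Mapping.lookup (boundary_map (top_chain v)) \<pi> = Poly_Mapping.lookup 0 \<pi>"
      proof (cases "\<exists>j\<in>cells. \<exists>q\<in>colors. \<pi> = ridge j q")
        case True
        then show ?thesis using lk lines by auto
      next
        case False
        have "(\<Sum>q\<in>colors. (-1) ^ (q - 1) * (if ridge j q = \<pi> then 1 else (0::int))) = 0" if "j \<in> cells" for j
          using False that by (intro sum.neutral) auto
        then show ?thesis by (simp add: lookup_boundary_top_chain)
      qed
    qed
  qed
qed

lemma boundary_top_chain_eq_0_iff_span:
  "boundary_map (top_chain v) = 0 \<longleftrightarrow> span_on core cells cross v"
  unfolding boundary_top_chain_eq_0_iff line_sums_zero_iff span_on_def ..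

end

section \<open>Spanning trees as nonvanishing minors\<close>

lemma span_on_combination: "span_on I A z (\<lambda>r. \<Sum>j\<in>I. a j * z j r)"
  by (auto simp: span_on_def)

lemma (in index_ideal) combination_on_core:
  assumes "i \<in> core" shows "(\<Sum>j\<in>core. a j * cross j i) = a i"
proof -
  have "(\<Sum>j\<in>core. a j * cross j i) = (\<Sum>j\<in>core. if j = i then a j else 0)"
    using assms by (intro sum.cong) (auto simp: cross_core)
  then show ?thesis using assms finite_core by simp
qed

context color_shifted_complex
begin

\<comment> \<open>Keeps the color set in the form \<open>{1..d + 1}\<close>, in which the constants of the locale mention it.\<close>
declare One_nat_def [simp del]

text \<open>Subcomplexes with full codimension-one skeleton correspond to the sets of top faces that they omit.\<close>

definition omitted :: "vertex set set \<Rightarrow> (nat \<Rightarrow> nat) set" where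
  "omitted T = {j \<in> cells. rainbow_face d j \<notin> T}"

lemma omitted_subset: "omitted T \<subseteq> cells"
  by (auto simp: omitted_def)

context
  fixes T :: "vertex set set"
  assumes TK: "T \<subseteq> K" and T_down: "\<forall>\<sigma>\<in>T. \<forall>\<tau>. \<tau> \<subseteq> \<sigma> \<longrightarrow> \<tau> \<in> T"
    and skel: "skeleton T (int d - 1) = skeleton K (int d - 1)"
begin

lemma finite_faces_T: "finite (faces T i)"
  using TK finite_K by (auto simp: faces_def intro: finite_subset)

lemma faces_T_codim1: "faces T (int d - 1) = faces K (int d - 1)"
proof -
  have "faces L i = {\<sigma> \<in> skeleton L i. face_dim \<sigma> = i}" for L :: "vertex set set" and i
    by (auto simp: faces_def skeleton_def)
  then show ?thesis using skel by simp
qed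

lemma faces_T_top: "faces T (int d) = rainbow_face d ` (cells - omitted T)"
proof -
  have "faces T (int d) = faces K (int d) \<inter> T" using TK by (auto simp: faces_def)
  then show ?thesis unfolding top_faces by (auto simp: omitted_def)
qed

lemma faces_T_above: "faces T (int d + 1) = {}"
  using TK card_face_le by (fastforce simp: faces_def face_dim_def)

lemma keys_top_chain_T_iff:
  "Poly_Mapping.keys (top_chain v) \<subseteq> faces T (int d) \<longleftrightarrow> (\<forall>r\<in>omitted T. v r = 0)"
proof
  assume keys: "Poly_Mapping.keys (top_chain v) \<subseteq> faces T (int d)"
  show "\<forall>r\<in>omitted T. v r = 0"
  proof
    fix r assume r: "r \<in> omitted T"
    then have "r \<in> cells" "rainbow_face d r \<notin> faces T (int d)" by (auto simp: omitted_def faces_def)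
    then show "v r = 0" using keys lookup_top_chain[of r v] by (metis in_keys_iff subsetD)
  qed
next
  assume "\<forall>r\<in>omitted T. v r = 0"
  then show "Poly_Mapping.keys (top_chain v) \<subseteq> faces T (int d)"
    unfolding faces_T_top by (intro order_trans[OF keys_top_chain] image_mono) auto
qed

lemma top_chain_of_keys_T:
  assumes "Poly_Mapping.keys c \<subseteq> faces T (int d)"
  obtains v where "c = top_chain v" "\<forall>r\<in>omitted T. v r = 0"
proof -
  have "faces T (int d) \<subseteq> faces K (int d)" using TK by (auto simp: faces_def)
  then have eq: "c = top_chain (\<lambda>j. Poly_Mapping.lookup c (rainbow_face d j))" (is "_ = top_chain ?v")
    by (intro top_chain_of_keys order_trans[OF assms])
  have "Poly_Mapping.keys (top_chain ?v) \<subseteq> faces T (int d)"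
    by (subst eq[symmetric]) (rule assms)
  from that[OF eq this[unfolded keys_top_chain_T_iff]] show ?thesis .
qed

lemma betti_top_eq_0_iff: "betti T (int d) = 0 \<longleftrightarrow> independent_on core (omitted T) cross"
proof -
  have "boundaries T (int d) = {0}"
    unfolding boundaries_def chain_grp_def faces_T_above
    by (auto simp: boundary_map_simps intro!: image_eqI[of _ _ 0])
  then have "betti T (int d) = 0 \<longleftrightarrow> (\<forall>z\<in>cycles T (int d). z = 0)"
    unfolding betti_eq_0_iff[OF T_down finite_faces_T] by (auto intro: exI[of _ 1])
  also have "\<dots> \<longleftrightarrow> independent_on core (omitted T) cross"
  proof
    assume triv: "\<forall>z\<in>cycles T (int d). z = 0"
    show "independent_on core (omitted T) cross" unfolding independent_on_def
    proof (intro allI impI ballI)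
      fix a i assume a: "\<forall>r\<in>omitted T. (\<Sum>j\<in>core. a j * cross j r) = 0" and i: "i \<in> core"
      let ?v = "\<lambda>r. \<Sum>j\<in>core. a j * cross j r"
      have "top_chain ?v \<in> cycles T (int d)"
        unfolding cycles_def chain_grp_def using a
        by (simp add: keys_top_chain_T_iff boundary_top_chain_eq_0_iff_span span_on_combination)
      then have "top_chain ?v = 0" using triv by blast
      then have "?v i = 0" using lookup_top_chain[of i ?v] i core_subset by auto
      then show "a i = 0" using combination_on_core[OF i] by simp
    qed
  next
    assume ind: "independent_on core (omitted T) cross"
    show "\<forall>z\<in>cycles T (int d). z = 0"
    proof
      fix z assume z: "z \<in> cycles T (int d)"
      then obtain v where v: "z = top_chain v" "\<forall>r\<in>omitted T. v r = 0"
        using top_chain_of_keys_T[of z] by (auto simp: cycles_def chain_grp_def)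
      from z have "span_on core cells cross v"
        unfolding boundary_top_chain_eq_0_iff_span[symmetric] using v by (simp add: cycles_def)
      then obtain a where a: "\<forall>r\<in>cells. v r = (\<Sum>j\<in>core. a j * cross j r)" by (auto simp: span_on_def)
      then have "\<forall>r\<in>omitted T. (\<Sum>j\<in>core. a j * cross j r) = 0" using v(2) omitted_subset by fastforce
      then have "\<forall>j\<in>core. a j = 0" using ind by (simp add: independent_on_def)
      then have "\<forall>r\<in>cells. v r = 0" using a by simp
      then show "z = 0" by (simp add: v(1) top_chain_def)
    qed
  qed
  finally show ?thesis .
qed

text \<open>A boundary in the large complex bounds in \<open>T\<close> iff the chain can be corrected by a cycle so as to vanish on
the omitted faces. This identifies the codimension-one homology of \<open>T\<close> with the cokernel of the matrix of
cycle coefficients at the omitted faces.\<close>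

lemma boundary_top_chain_in_boundaries_iff:
  "boundary_map (top_chain v) \<in> boundaries T (int d - 1) \<longleftrightarrow> span_on core (omitted T) cross v"
proof
  assume "boundary_map (top_chain v) \<in> boundaries T (int d - 1)"
  then obtain c where c: "Poly_Mapping.keys c \<subseteq> faces T (int d)" "boundary_map (top_chain v) = boundary_map c"
    by (auto simp: boundaries_def chain_grp_def)
  then obtain s where s: "c = top_chain s" "\<forall>r\<in>omitted T. s r = 0" using top_chain_of_keys_T by blast
  have "boundary_map (top_chain (\<lambda>j. v j - s j)) = 0"
    using c s by (simp add: top_chain_diff boundary_map_simps)
  then obtain a where "\<forall>r\<in>cells. v r - s r = (\<Sum>j\<in>core. a j * cross j r)"
    unfolding boundary_top_chain_eq_0_iff_span span_on_def by blast
  then show "span_on core (omitted T) cross v"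
    unfolding span_on_def using s(2) omitted_subset by (intro exI[of _ a]) fastforce
next
  assume "span_on core (omitted T) cross v"
  then obtain a where a: "\<forall>r\<in>omitted T. v r = (\<Sum>j\<in>core. a j * cross j r)" by (auto simp: span_on_def)
  let ?u = "\<lambda>r. \<Sum>j\<in>core. a j * cross j r"
  have "boundary_map (top_chain ?u) = 0"
    by (simp add: boundary_top_chain_eq_0_iff_span span_on_combination)
  then have "boundary_map (top_chain v) = boundary_map (top_chain (\<lambda>r. v r - ?u r))"
    by (simp only: top_chain_diff boundary_map_simps) simp
  moreover have "Poly_Mapping.keys (top_chain (\<lambda>r. v r - ?u r)) \<subseteq> faces T (int d)"
    using a by (simp add: keys_top_chain_T_iff)
  ultimately show "boundary_map (top_chain v) \<in> boundaries T (int d - 1)"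
    by (auto simp: boundaries_def chain_grp_def)
qed

lemma cycles_T_codim1: "cycles T (int d - 1) = range (\<lambda>v. boundary_map (top_chain v))"
proof -
  have "cycles T (int d - 1) = cycles K (int d - 1)"
    by (simp add: cycles_def chain_grp_def faces_T_codim1)
  also have "\<dots> = range (\<lambda>v. boundary_map (top_chain v))"
  proof
    show "cycles K (int d - 1) \<subseteq> range (\<lambda>v. boundary_map (top_chain v))"
    proof
      fix z assume "z \<in> cycles K (int d - 1)"
      from codim1_cycle_is_boundary[OF this] obtain w
        where w: "Poly_Mapping.keys w \<subseteq> faces K (int d)" "boundary_map w = z" by blast
      show "z \<in> range (\<lambda>v. boundary_map (top_chain v))"
        by (rule range_eqI[where x = "\<lambda>j. Poly_Mapping.lookup w (rainbow_face d j)"])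
           (simp only: top_chain_of_keys[OF w(1), symmetric] w(2))
    qed
    show "range (\<lambda>v. boundary_map (top_chain v)) \<subseteq> cycles K (int d - 1)"
    proof (rule order_trans[OF _ boundaries_subset_cycles[OF K_down]])
      show "range (\<lambda>v. boundary_map (top_chain v)) \<subseteq> boundaries K (int d - 1)"
      proof (rule image_subsetI)
        fix v
        have "Poly_Mapping.keys (top_chain v) \<subseteq> faces K (int d)"
          unfolding top_faces by (rule order_trans[OF keys_top_chain]) auto
        then show "boundary_map (top_chain v) \<in> boundaries K (int d - 1)"
          by (auto simp: boundaries_def chain_grp_def)
      qed
    qed
  qed
  finally show ?thesis .
qed

lemma betti_codim1_eq_0_iff:
  "betti T (int d - 1) = 0 \<longleftrightarrow> rationally_spanning_on core (omitted T) cross"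
  unfolding betti_eq_0_iff[OF T_down finite_faces_T] cycles_T_codim1 rationally_spanning_on_def
  by (simp add: boundary_map_simps(4)[symmetric] top_chain_scale[symmetric] boundary_top_chain_in_boundaries_iff)

lemma torsion_number_eq_fdet:
  assumes e: "bij_betw e {0..<m} core" and g: "bij_betw g {0..<m} (omitted T)"
    and det: "fdet m (\<lambda>i k. cross (e i) (g k)) \<noteq> 0"
  shows "betti T (int d) = 0" "betti T (int d - 1) = 0"
    "torsion_number T (int d - 1) = nat \<bar>fdet m (\<lambda>i k. cross (e i) (g k))\<bar>"
proof -
  show "betti T (int d) = 0"
    unfolding betti_top_eq_0_iff independent_on_iff_fdet[OF e g] by (rule det)
  obtain Y and h :: "(nat \<Rightarrow> int) \<Rightarrow> (nat \<Rightarrow> nat) \<Rightarrow> int" where Y: "finite Y"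
    "card Y = nat \<bar>fdet m (\<lambda>i k. cross (e i) (g k))\<bar>"
    "\<And>v. \<exists>!x. x \<in> Y \<and> span_on core (omitted T) cross (\<lambda>r. v r - h x r)"
    using transversal_if_fdet[OF e g, of cross, OF det] by blast
  show b: "betti T (int d - 1) = 0"
    unfolding betti_codim1_eq_0_iff by (rule rationally_spanning_if_transversal[OF Y(1,3)])
  have "torsion_number T (int d - 1) = card Y"
  proof (rule torsion_number_eq_card_transversal[OF T_down finite_faces_T b])
    show "boundary_map (top_chain (h x)) \<in> cycles T (int d - 1)" for x
      by (simp add: cycles_T_codim1)
    fix z assume "z \<in> cycles T (int d - 1)"
    then obtain v where "z = boundary_map (top_chain v)" by (auto simp: cycles_T_codim1)
    then have "z - boundary_map (top_chain (h x)) \<in> boundaries T (int d - 1) \<longleftrightarrow>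
        span_on core (omitted T) cross (\<lambda>r. v r - h x r)" for x
      by (simp add: boundary_top_chain_in_boundaries_iff flip: boundary_map_simps top_chain_diff)
    then show "\<exists>!x. x \<in> Y \<and> z - boundary_map (top_chain (h x)) \<in> boundaries T (int d - 1)"
      using Y(3)[of v] by simp
  qed
  then show "torsion_number T (int d - 1) = nat \<bar>fdet m (\<lambda>i k. cross (e i) (g k))\<bar>"
    using Y(2) by simp
qed

end

lemma betti_codim1_K: "betti K (int d - 1) = 0"
  unfolding betti_eq_0_iff[OF K_down finite_faces]
proof
  fix z assume "z \<in> cycles K (int d - 1)"
  from codim1_cycle_is_boundary[OF this] have "z \<in> boundaries K (int d - 1)"
    by (auto simp: boundaries_def chain_grp_def)
  then show "\<exists>k::nat. k > 0 \<and> frag_cmul (int k) z \<in> boundaries K (int d - 1)"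
    by (intro exI[of _ 1]) simp
qed

definition with_omitted :: "(nat \<Rightarrow> nat) set \<Rightarrow> vertex set set" where
  "with_omitted R = skeleton K (int d - 1) \<union> rainbow_face d ` (cells - R)"

lemma skeleton_alt: "\<sigma> \<in> skeleton K (int d - 1) \<longleftrightarrow> \<sigma> \<in> K \<and> card \<sigma> \<le> d"
  by (auto simp: skeleton_def face_dim_def)

lemma rainbow_in_K: "j \<in> cells \<Longrightarrow> rainbow_face d j \<in> K"
  by (simp add: cells_def)

lemma with_omitted_props:
  shows "with_omitted R \<subseteq> K" "\<forall>\<sigma>\<in>with_omitted R. \<forall>\<tau>. \<tau> \<subseteq> \<sigma> \<longrightarrow> \<tau> \<in> with_omitted R"
    "skeleton (with_omitted R) (int d - 1) = skeleton K (int d - 1)"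
    "R \<subseteq> cells \<Longrightarrow> omitted (with_omitted R) = R"
proof -
  show sub: "with_omitted R \<subseteq> K" by (auto simp: with_omitted_def skeleton_def rainbow_in_K)
  show "\<forall>\<sigma>\<in>with_omitted R. \<forall>\<tau>. \<tau> \<subseteq> \<sigma> \<longrightarrow> \<tau> \<in> with_omitted R"
  proof (intro ballI allI impI)
    fix \<sigma> \<tau> assume st: "\<sigma> \<in> with_omitted R" "\<tau> \<subseteq> \<sigma>"
    show "\<tau> \<in> with_omitted R"
    proof (cases "\<tau> = \<sigma>")
      case False
      have s: "\<sigma> \<in> K" using sub st by blast
      then have "card \<tau> < card \<sigma>" using False st finite_face by (intro psubset_card_mono) auto
      moreover have "\<tau> \<in> K" using K_down s st by blast
      ultimately have "\<tau> \<in> skeleton K (int d - 1)" using card_face_le[OF s] by (simp add: skeleton_alt)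
      then show ?thesis by (simp add: with_omitted_def)
    qed (use st in simp)
  qed
  show "skeleton (with_omitted R) (int d - 1) = skeleton K (int d - 1)"
    by (auto simp: with_omitted_def skeleton_def face_dim_def card_rainbow rainbow_in_K)
  show "omitted (with_omitted R) = R" if "R \<subseteq> cells"
    using that inj_on_rainbow card_rainbow
    by (auto simp: omitted_def with_omitted_def skeleton_alt inj_on_def)
qed

lemma with_omitted_omitted:
  assumes "T \<subseteq> K" "skeleton T (int d - 1) = skeleton K (int d - 1)"
  shows "with_omitted (omitted T) = T"
proof
  show "with_omitted (omitted T) \<subseteq> T"
    using assms by (auto simp: with_omitted_def omitted_def skeleton_def)
  show "T \<subseteq> with_omitted (omitted T)"
  proof
    fix \<sigma> assume s: "\<sigma> \<in> T"
    show "\<sigma> \<in> with_omitted (omitted T)"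
    proof (cases "card \<sigma> \<le> d")
      case True
      then show ?thesis using s assms(1) by (auto simp: with_omitted_def skeleton_alt)
    next
      case False
      then have "card \<sigma> = d + 1" using s assms(1) card_face_le[of \<sigma>] by fastforce
      then obtain j where "j \<in> cells" "\<sigma> = rainbow_face d j" using top_face_is_rainbow s assms(1) by blast
      then show ?thesis using s by (auto simp: with_omitted_def omitted_def)
    qed
  qed
qed

lemma ones_in_cells: "restrict (\<lambda>_. 1) colors \<in> cells - core"
proof -
  obtain \<sigma> where s: "\<sigma> \<in> K" using K_ne by blast
  obtain \<phi> where f: "\<phi> \<in> facets K" using facet_above[OF s] .
  then have fK: "\<phi> \<in> K" by (simp add: facets_def)
  have "q \<in> color ` \<phi>" if q: "q \<in> colors" for q
  proof (rule ccontr)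
    assume "q \<notin> color ` \<phi>"
    then have "\<phi> \<inter> color_class n q = {}" by (force simp: color_class_def)
    moreover have "card (\<phi> \<inter> color_class n q) = 1" using K_facets f q by blast
    ultimately show False by simp
  qed
  then have "color ` \<phi> = colors" using color_face_subset[OF fK] by blast
  then have "card \<phi> = d + 1" using card_face[OF fK] by simp
  then obtain j where j: "j \<in> cells" using top_face_is_rainbow[OF fK] by blast
  have "restrict (\<lambda>_. 1) colors \<in> cells"
    by (rule J_below[OF j], rule PiE_I) (use J_pos[OF j] in auto)
  moreover have "restrict (\<lambda>_. 1) colors \<notin> core" by (auto simp: core_def intro!: bexI[of _ 1])
  ultimately show ?thesis by blast
qed

text \<open>Only the dimension of the subcomplex needs an argument besides the two Betti numbers: the face with all indices
\<open>1\<close> lies outside the core, so a set of the size of the core cannot exhaust all top faces.\<close>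

lemma spanning_tree_iff:
  assumes "R \<subseteq> cells"
  shows "with_omitted R \<in> spanning_trees (int d) K \<longleftrightarrow>
     independent_on core R cross \<and> rationally_spanning_on core R cross" (is "?T \<in> _ \<longleftrightarrow> ?P")
proof -
  note props = with_omitted_props[of R]
  have "?T \<in> spanning_trees (int d) K \<longleftrightarrow>
     simplicial_complex_on (\<Union>K) ?T \<and> complex_dim ?T = int d \<and> ?P"
    unfolding spanning_trees_def
    using betti_top_eq_0_iff[OF props(1,2,3)] betti_codim1_eq_0_iff[OF props(1,2,3)]
      props(1,3) betti_codim1_K assms props(4) by auto
  moreover have "simplicial_complex_on (\<Union>K) ?T"
  proof -
    have "finite (\<Union>K)" using finite_K finite_face by blast
    moreover obtain \<sigma> where "\<sigma> \<in> K" using K_ne by blast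
    then have "{} \<in> ?T" using K_down by (auto simp: with_omitted_def skeleton_alt)
    ultimately show ?thesis using props(1,2) by (auto simp: simplicial_complex_on_def)
  qed
  moreover have "complex_dim ?T = int d" if ?P
  proof -
    have "card R = card core"
      using that finite_core assms finite_J by (intro card_eq_if_independent_spanning) (auto intro: finite_subset)
    moreover have "card core < card cells"
      using ones_in_cells core_subset finite_J by (intro psubset_card_mono) auto
    ultimately have "cells - R \<noteq> {}" using assms finite_J by (metis Diff_eq_empty_iff card_mono finite_subset not_le)
    then obtain j where "j \<in> cells - R" by blast
    then have mem: "rainbow_face d j \<in> ?T" by (simp add: with_omitted_def)
    have "finite (face_dim ` ?T)" using props(1) finite_K by (simp add: finite_subset)
    moreover have "face_dim (rainbow_face d j) = int d" by (simp add: face_dim_def card_rainbow)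
    then have "int d \<in> face_dim ` ?T" using mem by (metis image_eqI)
    moreover have "face_dim \<sigma> \<le> int d" if "\<sigma> \<in> ?T" for \<sigma>
      using card_face_le[of \<sigma>] that props(1) by (auto simp: face_dim_def)
    ultimately show ?thesis unfolding complex_dim_def by (intro Max_eqI) auto
  qed
  ultimately show ?thesis by blast
qed

definition cell_weight :: "(nat \<Rightarrow> nat) \<Rightarrow> vertex int_mpoly" where
  "cell_weight j = (\<Prod>q\<in>colors. indet (Vert q (j q)))"

lemma face_weight_rainbow: "face_weight (rainbow_face d j) = cell_weight j"
  unfolding face_weight_def rainbow_face_image cell_weight_def
  by (subst prod.reindex) (auto simp: inj_on_def)

lemma weighted_tree_number_minors:
  assumes e: "bij_betw e {0..<m} core"
    and g: "\<And>R. R \<subseteq> cells \<Longrightarrow> card R = m \<Longrightarrow> bij_betw (g R) {0..<m} R"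
  shows "weighted_tree_number (int d) K = (\<Sum>R | R \<subseteq> cells \<and> card R = m.
     (\<Prod>j\<in>cells - R. cell_weight j) * of_int ((fdet m (\<lambda>i k. cross (e i) (g R k)))\<^sup>2))"
proof -
  let ?D = "\<lambda>R. fdet m (\<lambda>i k. cross (e i) (g R k))"
  let ?S = "{R. R \<subseteq> cells \<and> card R = m \<and> ?D R \<noteq> 0}"
  have m: "card core = m" using bij_betw_same_card[OF e] by simp
  have tree: "with_omitted R \<in> spanning_trees (int d) K \<longleftrightarrow> R \<in> ?S" if R: "R \<subseteq> cells" for R
  proof -
    have fin: "finite R" using R finite_J by (rule finite_subset)
    show ?thesis
    proof (cases "card R = m")
      case True
      note gR = g[OF R True]
      note props = with_omitted_props[of R]
      have om: "omitted (with_omitted R) = R" using props(4) R by blast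
      have "rationally_spanning_on core R cross" if "?D R \<noteq> 0"
      proof -
        have "betti (with_omitted R) (int d - 1) = 0"
          using that gR om by (intro torsion_number_eq_fdet(2)[OF props(1,2,3) e, of "g R"]) simp_all
        then show ?thesis using betti_codim1_eq_0_iff[OF props(1,2,3)] om by simp
      qed
      then show ?thesis
        unfolding spanning_tree_iff[OF R] independent_on_iff_fdet[OF e gR] using R True by blast
    next
      case False
      then show ?thesis
        unfolding spanning_tree_iff[OF R]
        using card_eq_if_independent_spanning[OF finite_core fin, of cross] m by auto
    qed
  qed
  have "weighted_tree_number (int d) K = (\<Sum>R\<in>?S. (\<Prod>j\<in>cells - R. cell_weight j) * of_int ((?D R)\<^sup>2))"
    unfolding weighted_tree_number_def
  proof (rule sum.reindex_bij_witness[of _ with_omitted omitted])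
    fix T assume T: "T \<in> spanning_trees (int d) K"
    then have TK: "T \<subseteq> K" "skeleton T (int d - 1) = skeleton K (int d - 1)" by (auto simp: spanning_trees_def)
    show wo: "with_omitted (omitted T) = T" by (rule with_omitted_omitted[OF TK])
    show om: "omitted T \<in> ?S" using T by (simp only: wo flip: tree[OF omitted_subset[of T]])
    have down: "\<forall>\<sigma>\<in>T. \<forall>\<tau>. \<tau> \<subseteq> \<sigma> \<longrightarrow> \<tau> \<in> T" using T by (simp add: spanning_trees_def simplicial_complex_on_def)
    have "torsion_number T (int d - 1) = nat \<bar>?D (omitted T)\<bar>"
      using om by (intro torsion_number_eq_fdet(3)[OF TK(1) down TK(2) e] g) auto
    then have "of_nat ((torsion_number T (int d - 1))\<^sup>2) = (of_int ((?D (omitted T))\<^sup>2) :: vertex int_mpoly)"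
    proof -
      assume "torsion_number T (int d - 1) = nat \<bar>?D (omitted T)\<bar>"
      then have "int ((torsion_number T (int d - 1))\<^sup>2) = (?D (omitted T))\<^sup>2" by simp
      then show ?thesis by (metis of_int_of_nat_eq)
    qed
    moreover have "(\<Prod>\<tau>\<in>faces T (int d). face_weight \<tau>) = (\<Prod>j\<in>cells - omitted T. cell_weight j)"
      unfolding faces_T_top[OF TK(1) down TK(2)]
      by (subst prod.reindex) (auto simp: face_weight_rainbow intro: inj_on_subset[OF inj_on_rainbow])
    ultimately show "(\<Prod>j\<in>cells - omitted T. cell_weight j) * of_int ((?D (omitted T))\<^sup>2) =
        (\<Prod>\<tau>\<in>faces T (int d). face_weight \<tau>) * of_nat ((torsion_number T (int d - 1))\<^sup>2)" by simp
  next
    fix R assume "R \<in> ?S"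
    then show "omitted (with_omitted R) = R" "with_omitted R \<in> spanning_trees (int d) K"
      using with_omitted_props(4) tree[of R] by auto
  qed
  also have "\<dots> = (\<Sum>R | R \<subseteq> cells \<and> card R = m. (\<Prod>j\<in>cells - R. cell_weight j) * of_int ((?D R)\<^sup>2))"
    by (rule sum.mono_neutral_left) (use finite_J in auto)
  finally show ?thesis .
qed

end

section \<open>The Gram matrix of the cross-polytope cycles\<close>

definition partial_sum :: "(nat \<Rightarrow> 'a::field) \<Rightarrow> nat \<Rightarrow> 'a" where
  "partial_sum x j = (\<Sum>i=1..j. x i)"

text \<open>The diagonal entries in the \<open>L P L\<^sup>T\<close> factorization of the matrix with entries \<open>1 / x 1\<close>, increased by \<open>1 / x a\<close>
on the diagonal, for row and column indices from \<open>2\<close> on. They are found by Gaussian elimination: after the indices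
\<open>2, ..., c\<close> have been eliminated, the entry \<open>1 / x 1\<close> has become \<open>1 / partial_sum x c\<close>.\<close>

definition pivot :: "(nat \<Rightarrow> 'a::field) \<Rightarrow> nat \<Rightarrow> 'a" where
  "pivot x c = partial_sum x c / (x c * partial_sum x (c - 1))"

definition lower_entry :: "(nat \<Rightarrow> 'a::field) \<Rightarrow> nat \<Rightarrow> nat \<Rightarrow> 'a" where
  "lower_entry x a c = (if c = a then 1 else if 2 \<le> c \<and> c < a then x c / partial_sum x c else 0)"

context
  fixes x :: "nat \<Rightarrow> 'a::field"
  assumes x_nz: "\<And>i. 1 \<le> i \<Longrightarrow> x i \<noteq> 0" and D_nz: "\<And>i. 1 \<le> i \<Longrightarrow> partial_sum x i \<noteq> 0"
begin

lemma partial_sum_Suc: "partial_sum x (Suc j) = partial_sum x j + x (Suc j)"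
  by (simp add: partial_sum_def)

lemma pivot_eq: "1 \<le> c \<Longrightarrow> pivot x (Suc c) = 1 / x (Suc c) + 1 / partial_sum x c"
  using x_nz[of "Suc c"] D_nz[of c] by (simp add: pivot_def partial_sum_Suc field_simps)

lemma telescope:
  assumes "1 \<le> a"
  shows "(\<Sum>c=2..a. (x c / partial_sum x c) * pivot x c * (x c / partial_sum x c)) = 1 / x 1 - 1 / partial_sum x a"
  using assms
proof (induction a rule: dec_induct)
  case base
  show ?case by (simp add: partial_sum_def)
next
  case (step c)
  have nz: "x (Suc c) \<noteq> 0" "partial_sum x c \<noteq> 0" "partial_sum x (Suc c) \<noteq> 0"
    using x_nz[of "Suc c"] D_nz[of c] D_nz[of "Suc c"] step by auto
  have "(x (Suc c) / partial_sum x (Suc c)) * pivot x (Suc c) * (x (Suc c) / partial_sum x (Suc c)) =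
      x (Suc c) / (partial_sum x (Suc c) * partial_sum x c)"
    using nz by (simp add: pivot_def field_simps)
  also have "\<dots> = 1 / partial_sum x c - 1 / partial_sum x (Suc c)"
    using nz by (simp add: partial_sum_Suc field_simps)
  finally show ?case using step by simp
qed

text \<open>The sum telescopes to \<open>1 / x 1 - 1 / partial_sum x (a - 1)\<close> up to its last term, which supplies the rest.\<close>

lemma lower_gram_le:
  assumes "2 \<le> a" "a \<le> a'"
  shows "(\<Sum>c=2..a. lower_entry x a c * pivot x c * lower_entry x a' c) =
     1 / x 1 + (if a = a' then 1 / x a else 0)"
proof -
  obtain b where b: "a = Suc b" "1 \<le> b" using assms by (cases a) auto
  have nz: "x a \<noteq> 0" "partial_sum x b \<noteq> 0" "partial_sum x a \<noteq> 0"
    using x_nz D_nz b by auto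
  have "(\<Sum>c=2..a. lower_entry x a c * pivot x c * lower_entry x a' c) =
      (\<Sum>c=2..b. lower_entry x a c * pivot x c * lower_entry x a' c) + pivot x a * lower_entry x a' a"
    using b by (simp add: lower_entry_def)
  also have "(\<Sum>c=2..b. lower_entry x a c * pivot x c * lower_entry x a' c) =
      (\<Sum>c=2..b. (x c / partial_sum x c) * pivot x c * (x c / partial_sum x c))"
    using b assms by (intro sum.cong) (auto simp: lower_entry_def)
  also have "\<dots> = 1 / x 1 - 1 / partial_sum x b" by (rule telescope[OF b(2)])
  also have "pivot x a * lower_entry x a' a = 1 / partial_sum x b + (if a = a' then 1 / x a else 0)"
  proof (cases "a = a'")
    case True
    then show ?thesis using pivot_eq[OF b(2)] b by (simp add: lower_entry_def)
  next
    case False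
    then have "lower_entry x a' a = x a / partial_sum x a" using assms by (simp add: lower_entry_def)
    then show ?thesis using False nz b by (simp add: pivot_def)
  qed
  finally show ?thesis by simp
qed

lemma lower_gram:
  assumes "2 \<le> a" "2 \<le> a'"
  shows "(\<Sum>c=2..a. lower_entry x a c * pivot x c * lower_entry x a' c) =
     1 / x 1 + (if a = a' then 1 / x a else 0)"
proof (cases "a \<le> a'")
  case False
  have "(\<Sum>c=2..a. lower_entry x a c * pivot x c * lower_entry x a' c) =
      (\<Sum>c=2..a'. lower_entry x a c * pivot x c * lower_entry x a' c)"
    using False by (intro sum.mono_neutral_right) (auto simp: lower_entry_def)
  also have "\<dots> = (\<Sum>c=2..a'. lower_entry x a' c * pivot x c * lower_entry x a c)"
    by (simp add: mult_ac)
  also have "\<dots> = 1 / x 1" using lower_gram_le[of a' a] assms False by simp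
  finally show ?thesis using False by simp
qed (rule lower_gram_le[OF assms(1)])

end

context index_ideal
begin

lemma axis_gram:
  assumes "2 \<le> a" "2 \<le> a'"
  shows "(\<Sum>b=1..a. of_int (axis_sign a b) * (1 / x b) * of_int (axis_sign a' b)) =
     1 / x 1 + (if a = a' then 1 / x a else (0::'f::field))"
proof -
  have "(\<Sum>b=1..a. of_int (axis_sign a b) * (1 / x b) * of_int (axis_sign a' b)) =
      (\<Sum>b\<in>{1, a}. of_int (axis_sign a b) * (1 / x b) * of_int (axis_sign a' b))"
    using assms by (intro sum.mono_neutral_right) (auto simp: axis_sign_def)
  also have "\<dots> = 1 / x 1 + (if a = a' then 1 / x a else 0)"
    using assms by (auto simp: axis_sign_def)
  finally show ?thesis .
qed

lemma cross_zero_outside: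
  assumes "j \<in> core" "r \<in> J" "r \<notin> PiE Q (\<lambda>q. {1..j q})"
  shows "cross j r = 0"
proof -
  have "\<exists>q\<in>Q. r q \<notin> {1..j q}"
    using assms(2,3) J_PiE by (auto simp: PiE_def Pi_def)
  then obtain q where q: "q \<in> Q" "\<not> r q \<le> j q" using J_pos[OF assms(2)] by auto
  then have "2 \<le> j q" using assms by (auto simp: core_def)
  then have "axis_sign (j q) (r q) = 0" using q by (auto simp: axis_sign_def)
  then show ?thesis using q finite_Q by (auto simp: cross_def prod_zero_iff)
qed

context
  fixes x :: "'q \<Rightarrow> nat \<Rightarrow> 'f::field"
  assumes x_nz: "\<And>q i. 1 \<le> i \<Longrightarrow> x q i \<noteq> 0"
    and D_nz: "\<And>q i. 1 \<le> i \<Longrightarrow> partial_sum (x q) i \<noteq> 0"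
begin

definition lower :: "('q \<Rightarrow> nat) \<Rightarrow> ('q \<Rightarrow> nat) \<Rightarrow> 'f" where
  "lower j c = (\<Prod>q\<in>Q. lower_entry (x q) (j q) (c q))"

text \<open>Both sides are products over the colors of one-dimensional Gram sums. On either side the summation over the
ideal, or over its core, may be replaced by one over the box below \<open>j\<close>: that box is contained in the ideal, and the
terms outside it vanish.\<close>

lemma cross_gram_eq_lower_gram:
  assumes j: "j \<in> core" and i: "i \<in> core"
  shows "(\<Sum>r\<in>J. of_int (cross j r) * (\<Prod>q\<in>Q. 1 / x q (r q)) * of_int (cross i r)) =
         (\<Sum>c\<in>core. lower j c * (\<Prod>q\<in>Q. pivot (x q) (c q)) * lower i c)"
proof -
  have J: "j \<in> J" "\<And>q. q \<in> Q \<Longrightarrow> 2 \<le> j q" "\<And>q. q \<in> Q \<Longrightarrow> 2 \<le> i q" using i j by (auto simp: core_def)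
  have "(\<Sum>r\<in>J. of_int (cross j r) * (\<Prod>q\<in>Q. 1 / x q (r q)) * of_int (cross i r)) =
      (\<Sum>r\<in>PiE Q (\<lambda>q. {1..j q}). of_int (cross j r) * (\<Prod>q\<in>Q. 1 / x q (r q)) * of_int (cross i r))"
    using J_below[OF J(1)] cross_zero_outside[OF j] finite_J
    by (intro sum.mono_neutral_right) auto
  also have "\<dots> = (\<Prod>q\<in>Q. \<Sum>b=1..j q. of_int (axis_sign (j q) b) * (1 / x q b) * of_int (axis_sign (i q) b))"
    using finite_Q by (subst prod_sum_PiE) (auto simp: cross_def prod.distrib prod_dividef)
  also have "\<dots> = (\<Prod>q\<in>Q. \<Sum>c=2..j q. lower_entry (x q) (j q) c * pivot (x q) c * lower_entry (x q) (i q) c)"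
  proof (rule prod.cong[OF refl])
    fix q assume q: "q \<in> Q"
    show "(\<Sum>b=1..j q. of_int (axis_sign (j q) b) * (1 / x q b) * of_int (axis_sign (i q) b)) =
        (\<Sum>c=2..j q. lower_entry (x q) (j q) c * pivot (x q) c * lower_entry (x q) (i q) c)"
      unfolding axis_gram[OF J(2)[OF q] J(3)[OF q]]
      by (rule lower_gram[symmetric, OF x_nz D_nz J(2)[OF q] J(3)[OF q]])
  qed
  also have "\<dots> = (\<Sum>c\<in>PiE Q (\<lambda>q. {2..j q}). lower j c * (\<Prod>q\<in>Q. pivot (x q) (c q)) * lower i c)"
    using finite_Q by (subst prod_sum_PiE) (auto simp: lower_def prod.distrib)
  also have "\<dots> = (\<Sum>c\<in>core. lower j c * (\<Prod>q\<in>Q. pivot (x q) (c q)) * lower i c)"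
  proof (rule sum.mono_neutral_left)
    show "finite core" by (rule finite_core)
    show "PiE Q (\<lambda>q. {2..j q}) \<subseteq> core"
    proof
      fix c assume c: "c \<in> PiE Q (\<lambda>q. {2..j q})"
      have c2: "2 \<le> c q" "c q \<le> j q" if "q \<in> Q" for q using PiE_mem[OF c that] by auto
      have "c \<in> PiE Q (\<lambda>q. {1..j q})" using c by (rule subsetD[OF PiE_mono, rotated]) auto
      then have "c \<in> J" by (rule J_below[OF J(1)])
      then show "c \<in> core" using c2 by (simp add: core_def)
    qed
    show "\<forall>c\<in>core - PiE Q (\<lambda>q. {2..j q}). lower j c * (\<Prod>q\<in>Q. pivot (x q) (c q)) * lower i c = 0"
    proof
      fix c assume c: "c \<in> core - PiE Q (\<lambda>q. {2..j q})"
      then have "\<exists>q\<in>Q. c q \<notin> {2..j q}"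
        using J_PiE core_subset by (auto simp: PiE_def Pi_def)
      then obtain q where q: "q \<in> Q" "c q \<notin> {2..j q}" by blast
      moreover have "2 \<le> c q" using c q(1) by (simp add: core_def)
      ultimately have q: "q \<in> Q" "j q < c q" by auto
      then have "lower_entry (x q) (j q) (c q) = 0" by (simp add: lower_entry_def)
      then have "lower j c = 0" using q finite_Q by (auto simp: lower_def prod_zero_iff)
      then show "lower j c * (\<Prod>q\<in>Q. pivot (x q) (c q)) * lower i c = 0" by simp
    qed
  qed
  finally show ?thesis .
qed

text \<open>A nonzero term of the Leibniz expansion belongs to a permutation that decreases every coordinate; the total sum of
all coordinates is preserved, so the permutation is the identity. Arguing this way, no enumeration compatible
with the order has to be chosen.\<close>

lemma fdet_lower:
  assumes e: "bij_betw e {0..<m} core"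
  shows "fdet m (\<lambda>i k. lower (e i) (e k)) = 1"
proof -
  let ?U = "{0..<m}"
  define t where "t p = signof p * (\<Prod>i\<in>?U. lower (e i) (e (p i)))" for p
  have "fdet m (\<lambda>i k. lower (e i) (e k)) = (\<Sum>p | p permutes ?U. t p)"
    unfolding fdet_def det_def'[OF mat_carrier] t_def
    by (intro sum.cong refl arg_cong2[where f="(*)"] prod.cong) (auto dest: permutes_in_image)
  also have "\<dots> = (\<Sum>p\<in>{id}. t p)"
  proof (rule sum.mono_neutral_right)
    show "finite {p. p permutes ?U}" by (simp add: finite_permutations)
    show "{id} \<subseteq> {p. p permutes ?U}" by (simp add: permutes_id)
    show "\<forall>p\<in>{p. p permutes ?U} - {id}. t p = 0"
    proof (rule ccontr)
      assume "\<not> (\<forall>p\<in>{p. p permutes ?U} - {id}. t p = 0)"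
      then obtain p where p: "p permutes ?U" "p \<noteq> id" "t p \<noteq> 0" by auto
      have le: "e (p i) q \<le> e i q" if "i \<in> ?U" "q \<in> Q" for i q
      proof -
        have "lower (e i) (e (p i)) \<noteq> 0" using p(3) that unfolding t_def by auto
        then have "lower_entry (x q) (e i q) (e (p i) q) \<noteq> 0"
          using that finite_Q unfolding lower_def by (simp add: prod_zero_iff)
        then show ?thesis by (auto simp: lower_entry_def split: if_splits)
      qed
      \<comment> \<open>The sum of the coordinates is a strictly monotone rank function.\<close>
      define w where "w i = (\<Sum>q\<in>Q. e i q)" for i
      have wle: "w (p i) \<le> w i" if "i \<in> ?U" for i
        unfolding w_def using le[OF that] by (intro sum_mono) auto
      have "(\<Sum>i\<in>?U. w (p i)) = (\<Sum>i\<in>?U. w i)"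
        using sum.permute[OF p(1), of w] by (simp add: o_def)
      then have weq: "w (p i) = w i" if "i \<in> ?U" for i
        using sum_mono_inv[of "\<lambda>i. w (p i)" ?U w, OF _ wle that] by simp
      have "p i = i" if i: "i \<in> ?U" for i
      proof -
        have pi: "p i \<in> ?U" using p(1) i by (simp add: permutes_in_image del: atLeastLessThan_iff)
        have "e (p i) q = e i q" if "q \<in> Q" for q
          using sum_mono_inv[of "e (p i)" Q "e i", OF _ le[OF i] that] weq[OF i] finite_Q by (simp add: w_def)
        moreover have "e (p i) \<in> J" "e i \<in> J" using e pi i core_subset by (auto simp: bij_betw_def)
        ultimately have "e (p i) = e i" by (intro J_eqI)
        then show ?thesis using e pi i by (auto simp: bij_betw_def inj_on_def)
      qed
      then have "p = id" using p(1) by (metis eq_id_iff permutes_not_in)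
      then show False using p(2) by simp
    qed
  qed
  also have "\<dots> = 1" by (simp add: t_def lower_def lower_entry_def)
  finally show ?thesis .
qed

text \<open>The Cauchy--Binet formula is used in both directions: first to recognise the sum as a Gram determinant, then
for the triangular factorization of that determinant, where only one set of columns is available.\<close>

lemma sum_cross_minors:
  assumes e: "bij_betw e {0..<m} core"
    and g: "\<And>R. R \<subseteq> J \<Longrightarrow> card R = m \<Longrightarrow> bij_betw (g R) {0..<m} R"
  shows "(\<Sum>R | R \<subseteq> J \<and> card R = m. (\<Prod>r\<in>R. \<Prod>q\<in>Q. 1 / x q (r q)) *
       of_int ((fdet m (\<lambda>i k. cross (e i) (g R k)))\<^sup>2)) = (\<Prod>c\<in>core. \<Prod>q\<in>Q. pivot (x q) (c q))"
proof -
  have fdet_of_int: "of_int (fdet m M) = fdet m (\<lambda>i k. of_int (M i k) :: 'f)" for M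
  proof -
    have "mat m m (\<lambda>(i,k). of_int (M i k) :: 'f) = map_mat of_int (mat m m (\<lambda>(i,k). M i k))"
      by (intro eq_matI) auto
    then show ?thesis by (simp add: fdet_def of_int_hom.hom_det)
  qed
  have m: "card core = m" using bij_betw_same_card[OF e] by simp
  have full: "R = core" if "R \<subseteq> core" "card R = m" for R
    using that m by (intro card_subset_eq[OF finite_core]) auto
  then have only: "{R. R \<subseteq> core \<and> card R = m} = {core}"
    using m by auto
  have ecore: "e i \<in> core" if "i < m" for i using e that by (auto simp: bij_betw_def)
  have "(\<Sum>R | R \<subseteq> J \<and> card R = m. (\<Prod>r\<in>R. \<Prod>q\<in>Q. 1 / x q (r q)) *
       of_int ((fdet m (\<lambda>i k. cross (e i) (g R k)))\<^sup>2)) =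
     fdet m (\<lambda>i k. \<Sum>r\<in>J. of_int (cross (e i) r) * (\<Prod>q\<in>Q. 1 / x q (r q)) * of_int (cross (e k) r))"
    by (subst fdet_cauchy_binet_gram[OF finite_J g], assumption+) (simp add: fdet_of_int)
  also have "\<dots> = fdet m (\<lambda>i k. \<Sum>c\<in>core. lower (e i) c * (\<Prod>q\<in>Q. pivot (x q) (c q)) * lower (e k) c)"
    unfolding fdet_def
    by (intro arg_cong[where f=det] eq_matI) (auto simp: cross_gram_eq_lower_gram ecore)
  also have "\<dots> = (\<Sum>R | R \<subseteq> core \<and> card R = m. (\<Prod>c\<in>R. \<Prod>q\<in>Q. pivot (x q) (c q)) *
      (fdet m (\<lambda>i k. lower (e i) (e k)))\<^sup>2)"
    by (rule fdet_cauchy_binet_gram[OF finite_core, where g = "\<lambda>_. e"]) (use e full in blast)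
  also have "\<dots> = (\<Prod>c\<in>core. \<Prod>q\<in>Q. pivot (x q) (c q))"
    unfolding only fdet_lower[OF e] by simp
  finally show ?thesis .
qed

end

end

section \<open>The weighted tree-number\<close>

lemma to_fract_prod: "to_fract (prod f A) = (\<Prod>a\<in>A. to_fract (f a))"
  by (induction A rule: infinite_finite_induct) auto

lemma to_fract_of_int: "to_fract (of_int k) = of_int k"
proof -
  have nat: "to_fract (of_nat m) = of_nat m" for m by (induction m) auto
  show ?thesis by (cases k rule: int_cases2) (simp_all add: nat)
qed

lemma lookup_indet_single:
  "Poly_Mapping.lookup (indet v) (Poly_Mapping.single w 1) = (if v = w then 1 else 0)"
proof (cases "v = w")
  case False
  have "Poly_Mapping.lookup (Poly_Mapping.single v (1::nat)) v \<noteq> Poly_Mapping.lookup (Poly_Mapping.single w (1::nat)) v"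
    using False by (simp add: lookup_single)
  then have "Poly_Mapping.single v (1::nat) \<noteq> Poly_Mapping.single w 1" by metis
  then show ?thesis using False by (simp add: indet_def lookup_single)
qed (simp add: indet_def)

lemma indet_nonzero: "indet v \<noteq> 0"
  using lookup_indet_single[of v v] by auto

lemma D_sum_nonzero:
  assumes "1 \<le> j" shows "D_sum q j \<noteq> 0"
proof -
  have "Poly_Mapping.lookup (D_sum q j) (Poly_Mapping.single (Vert q 1) 1) = (\<Sum>i=1..j. if i = 1 then 1 else 0)"
    unfolding D_sum_def by (simp add: Poly_Mapping.lookup_sum lookup_indet_single[unfolded One_nat_def])
  also have "\<dots> = 1" using assms by simp
  finally show ?thesis by auto
qed

abbreviation vertex_fract :: "nat \<Rightarrow> nat \<Rightarrow> vertex int_mpoly fract" where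
  "vertex_fract q i \<equiv> to_fract (indet (Vert q i))"

lemma partial_sum_vertex_fract: "partial_sum (vertex_fract q) j = to_fract (D_sum q j)"
  by (simp add: partial_sum_def D_sum_def)

theorem (in color_shifted_complex) weighted_tree_number_formula:
  "to_fract (weighted_tree_number (int d) K) =
     (\<Prod>j\<in>cells. \<Prod>q\<in>colors. vertex_fract q (j q)) *
     (\<Prod>c\<in>core. \<Prod>q\<in>colors. pivot (vertex_fract q) (c q))"
proof -
  obtain e where e: "bij_betw e {0..<card core} core"
    using ex_bij_betw_nat_finite[OF finite_core] by blast
  have "\<exists>g. \<forall>R. R \<subseteq> cells \<and> card R = card core \<longrightarrow> bij_betw (g R) {0..<card core} R"
  proof (rule choice, rule allI)
    fix R
    show "\<exists>f. R \<subseteq> cells \<and> card R = card core \<longrightarrow> bij_betw f {0..<card core} R"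
      using ex_bij_betw_nat_finite[of R] finite_J by (metis finite_subset)
  qed
  then obtain g where g: "\<And>R. R \<subseteq> cells \<Longrightarrow> card R = card core \<Longrightarrow> bij_betw (g R) {0..<card core} R" by blast
  let ?w = "\<lambda>j. \<Prod>q\<in>colors. vertex_fract q (j q)"
  let ?D = "\<lambda>R. fdet (card core) (\<lambda>i k. cross (e i) (g R k))"
  have cw: "to_fract (cell_weight j) = ?w j" for j by (simp add: cell_weight_def to_fract_prod)
  have w_nz: "?w j \<noteq> 0" for j by (simp add: indet_nonzero)
  have "to_fract (weighted_tree_number (int d) K) =
      (\<Sum>R | R \<subseteq> cells \<and> card R = card core. (\<Prod>j\<in>cells - R. ?w j) * of_int ((?D R)\<^sup>2))"
    by (subst weighted_tree_number_minors[OF e g], assumption+)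
       (simp only: to_fract_sum to_fract_mult to_fract_prod[of cell_weight] cw to_fract_of_int)
  also have "\<dots> = (\<Sum>R | R \<subseteq> cells \<and> card R = card core. (\<Prod>j\<in>cells. ?w j) *
      ((\<Prod>j\<in>R. \<Prod>q\<in>colors. 1 / vertex_fract q (j q)) * of_int ((?D R)\<^sup>2)))"
  proof (rule sum.cong[OF refl])
    fix R assume "R \<in> {R. R \<subseteq> cells \<and> card R = card core}"
    then have R: "R \<subseteq> cells" by simp
    have "(\<Prod>j\<in>cells. ?w j) = (\<Prod>j\<in>cells - R. ?w j) * (\<Prod>j\<in>R. ?w j)"
      using prod.subset_diff[OF R finite_J] .
    moreover have "(\<Prod>j\<in>R. \<Prod>q\<in>colors. 1 / vertex_fract q (j q)) = 1 / (\<Prod>j\<in>R. ?w j)"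
      by (simp add: prod_dividef)
    moreover have "(\<Prod>j\<in>R. ?w j) \<noteq> 0" using w_nz R finite_J by (simp add: prod_zero_iff finite_subset)
    ultimately show "(\<Prod>j\<in>cells - R. ?w j) * of_int ((?D R)\<^sup>2) = (\<Prod>j\<in>cells. ?w j) *
      ((\<Prod>j\<in>R. \<Prod>q\<in>colors. 1 / vertex_fract q (j q)) * of_int ((?D R)\<^sup>2))" by simp
  qed
  also have "\<dots> = (\<Prod>j\<in>cells. ?w j) * (\<Prod>c\<in>core. \<Prod>q\<in>colors. pivot (vertex_fract q) (c q))"
    unfolding sum_distrib_left[symmetric]
    by (subst sum_cross_minors[OF _ _ e g]) (auto simp: indet_nonzero partial_sum_vertex_fract D_sum_nonzero)
  finally show ?thesis .
qed

text \<open>Since no index of \<open>\<sigma>\<close> is \<open>1\<close>, every proper face of \<open>\<sigma>\<close> also lies in a facet in which some vertex of \<open>\<sigma>\<close> is shifted to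
the first of its color, so purity survives. By maximality no other face shifts down to \<open>\<sigma>\<close>.\<close>

lemma color_shifted_remove_maximal_facet:
  assumes cs: "color_shifted d n \<Delta>" and \<sigma>: "\<sigma> = rainbow_face d l" "\<sigma> \<in> facets \<Delta>"
    and maximal: "\<forall>\<tau>\<in>facets \<Delta>. componentwise_le d \<sigma> \<tau> \<longrightarrow> \<tau> = \<sigma>"
    and l: "\<forall>q\<in>{1..d + 1}. l q \<ge> 2"
  shows "color_shifted d n (\<Delta> - {\<sigma>})"
proof -
  interpret color_shifted_complex d n \<Delta> by unfold_locales (rule cs)
  have \<sigma>K: "\<sigma> \<in> \<Delta>" and \<sigma>max: "\<And>\<tau>. \<tau> \<in> \<Delta> \<Longrightarrow> \<sigma> \<subseteq> \<tau> \<Longrightarrow> \<tau> = \<sigma>"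
    using \<sigma>(2) by (auto simp: facets_def)
  have down: "\<tau> \<in> \<Delta> - {\<sigma>}" if "\<rho> \<in> \<Delta> - {\<sigma>}" "\<tau> \<subseteq> \<rho>" for \<rho> \<tau>
    using that K_down \<sigma>max by blast
  have lv: "Vert q (l q) \<in> \<sigma>" if "q \<in> colors" for q
    using that by (auto simp: \<sigma>(1) rainbow_face_image)
  have "\<sigma> \<noteq> {}" using lv[of 1] by auto
  moreover have "{} \<in> \<Delta>" using K_down \<sigma>K by blast
  ultimately have cplx: "simplicial_complex_on (\<Union>q\<in>colors. color_class n q) (\<Delta> - {\<sigma>})"
    unfolding simplicial_complex_on_def
  proof (intro conjI ballI allI impI)
    show "finite (\<Union>q\<in>colors. color_class n q)" by (rule finite_V)
    show "\<Delta> - {\<sigma>} \<subseteq> Pow (\<Union>q\<in>colors. color_class n q)" using K_V by blast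
  qed (use down in blast)+
  have fac: "card (\<phi> \<inter> color_class n q) = 1" if phi: "\<phi> \<in> facets (\<Delta> - {\<sigma>})" and q: "q \<in> colors" for \<phi> q
  proof -
    have pK: "\<phi> \<in> \<Delta>" "\<phi> \<noteq> \<sigma>" and pmax: "\<And>\<tau>. \<tau> \<in> \<Delta> \<Longrightarrow> \<tau> \<noteq> \<sigma> \<Longrightarrow> \<phi> \<subseteq> \<tau> \<Longrightarrow> \<tau> = \<phi>"
      using phi by (auto simp: facets_def)
    have "\<not> \<phi> \<subseteq> \<sigma>"
    proof
      assume sub: "\<phi> \<subseteq> \<sigma>"
      then obtain v where v: "v \<in> \<sigma>" "v \<notin> \<phi>" using pK by blast
      then obtain p where p: "p \<in> colors" "v = Vert p (l p)" by (auto simp: \<sigma>(1) rainbow_face_image)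
      have lp: "1 < l p" using l p(1) by fastforce
      let ?\<tau> = "\<sigma> - {Vert p (l p)} \<union> {Vert p 1}"
      have "?\<tau> \<in> \<Delta>" using K_shift[OF \<sigma>K lv[OF p(1)], of 1] lp by simp
      moreover have new: "Vert p 1 \<notin> \<sigma>" using lp by (auto simp: \<sigma>(1) rainbow_face_image)
      moreover have "\<phi> \<subseteq> ?\<tau>" using sub v p by blast
      ultimately have "?\<tau> = \<phi>" using pmax[of ?\<tau>] by blast
      then show False using new sub by blast
    qed
    then have "\<phi> \<in> facets \<Delta>" using pK pmax by (auto simp: facets_def)
    then show ?thesis using K_facets q by blast
  qed
  have shift: "(\<rho> - {Vert q j}) \<union> {Vert q j'} \<in> \<Delta> - {\<sigma>}"
    if r: "\<rho> \<in> \<Delta> - {\<sigma>}" "Vert q j \<in> \<rho>" "1 \<le> j'" "j' < j" for \<rho> q j j'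
  proof -
    have rK: "\<rho> \<in> \<Delta>" using r by simp
    have q: "q \<in> colors" using vertex_props(1)[OF rK r(2)] by simp
    have "(\<rho> - {Vert q j}) \<union> {Vert q j'} \<noteq> \<sigma>"
    proof
      assume eq: "(\<rho> - {Vert q j}) \<union> {Vert q j'} = \<sigma>"
      have new: "Vert q j' \<notin> \<rho>"
        using inj_onD[OF inj_on_color[OF rK], of "Vert q j" "Vert q j'"] r(2,4) by auto
      have "0 < card \<rho>" using r(2) finite_face[OF rK] by (auto simp: card_gt_0_iff)
      then have "card \<sigma> = card \<rho>"
        unfolding eq[symmetric] using new r(2) finite_face[OF rK] by simp
      then have "card \<rho> = d + 1" by (simp add: \<sigma>(1) card_rainbow)
      then obtain i where i: "\<rho> = rainbow_face d i" using top_face_is_rainbow[OF rK] by blast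
      have rf: "\<rho> \<in> facets \<Delta>"
      proof -
        have "\<tau> = \<rho>" if "\<tau> \<in> \<Delta>" "\<rho> \<subseteq> \<tau>" for \<tau>
          using card_face_le[OF that(1)] \<open>card \<rho> = d + 1\<close> that finite_face[OF that(1)]
          by (metis card_seteq)
        then show ?thesis using rK by (auto simp: facets_def)
      qed
      have "l p \<le> i p" if p: "p \<in> colors" for p
      proof -
        have "Vert p (l p) \<in> (\<rho> - {Vert q j}) \<union> {Vert q j'}" using lv[OF p] eq by simp
        then consider "Vert p (l p) \<in> \<rho>" | "p = q" "l p = j'" by auto
        then show ?thesis
        proof cases
          case 1 then show ?thesis by (auto simp: i rainbow_face_image)
        next
          case 2
          have "j = i q" using r(2) by (auto simp: i rainbow_face_image)
          then show ?thesis using 2 r(4) by simp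
        qed
      qed
      then have "componentwise_le d \<sigma> \<rho>" unfolding componentwise_le_def \<sigma>(1) i by blast
      then show False using maximal rf r(1) by blast
    qed
    then show ?thesis using K_shift[OF rK r(2-4)] by simp
  qed
  show ?thesis unfolding color_shifted_def using cplx fac shift by blast
qed

theorem theorem5p2:
  fixes d :: nat and n l :: "nat \<Rightarrow> nat" and \<Delta> :: "vertex set set" and \<sigma> :: "vertex set"
  assumes "d \<ge> 1"
    and "color_shifted d n \<Delta>"
    and "\<sigma> = rainbow_face d l"
    and "\<sigma> \<in> facets \<Delta>"
    and "\<forall>\<tau>\<in>facets \<Delta>. componentwise_le d \<sigma> \<tau> \<longrightarrow> \<tau> = \<sigma>"
    and "\<forall>q\<in>{1..d + 1}. l q \<ge> 2"
  shows "to_fract (weighted_tree_number (int d) \<Delta>) /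
           to_fract (weighted_tree_number (int d) (\<Delta> - {\<sigma>})) =
         (\<Prod>q = 1..d + 1. to_fract (D_sum q (l q)) / to_fract (D_sum q (l q - 1)))"
proof -
  interpret A: color_shifted_complex d n \<Delta> by unfold_locales (rule assms(2))
  interpret B: color_shifted_complex d n "\<Delta> - {\<sigma>}"
    by unfold_locales (rule color_shifted_remove_maximal_facet[OF assms(2-6)])
  let ?C = "{1..d + 1}"
  let ?w = "\<lambda>j. \<Prod>q\<in>?C. vertex_fract q (j q)" and ?p = "\<lambda>j. \<Prod>q\<in>?C. pivot (vertex_fract q) (j q)"
  \<comment> \<open>Index vectors of faces are undefined off the set of colors; \<open>l\<close> need not be.\<close>
  define l' where "l' = restrict l ?C"
  have l'q: "l' q = l q" if "q \<in> ?C" for q using that by (simp add: l'_def del: atLeastAtMost_iff)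
  have rl: "rainbow_face d l' = \<sigma>"
    unfolding assms(3) A.rainbow_face_eq_iff using l'q by blast
  have "l' \<in> PiE ?C (\<lambda>_. UNIV)" by (simp add: l'_def)
  then have l'A: "l' \<in> A.cells" using assms(4) rl by (auto simp: A.cells_def facets_def)
  have cells: "B.cells = A.cells - {l'}"
    using rl A.inj_on_rainbow l'A by (auto simp: A.cells_def B.cells_def inj_on_def)
  have l'core: "l' \<in> A.core" unfolding A.core_def using l'A assms(6) l'q by simp
  have core: "B.core = A.core - {l'}" unfolding B.core_def A.core_def unfolding cells by auto
  have nz: "vertex_fract q i \<noteq> 0" for q i by (simp add: indet_nonzero)
  have D: "to_fract (D_sum q j) \<noteq> 0" if "1 \<le> j" for q j using D_sum_nonzero[OF that] by simp
  have pnz: "?p j \<noteq> 0" if "j \<in> A.core" for j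
    using that nz D unfolding A.core_def by (force simp: prod_zero_iff pivot_def partial_sum_vertex_fract)
  have wA: "(\<Prod>j\<in>A.cells. ?w j) = ?w l' * (\<Prod>j\<in>B.cells. ?w j)"
    unfolding cells by (rule prod.remove[OF A.finite_J l'A])
  have pA: "(\<Prod>j\<in>A.core. ?p j) = ?p l' * (\<Prod>j\<in>B.core. ?p j)"
    unfolding core by (rule prod.remove[OF A.finite_core l'core])
  have "to_fract (weighted_tree_number (int d) \<Delta>) =
      (?w l' * (\<Prod>j\<in>B.cells. ?w j)) * (?p l' * (\<Prod>j\<in>B.core. ?p j))"
    unfolding A.weighted_tree_number_formula wA pA ..
  moreover have "to_fract (weighted_tree_number (int d) (\<Delta> - {\<sigma>})) = (\<Prod>j\<in>B.cells. ?w j) * (\<Prod>j\<in>B.core. ?p j)"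
    by (rule B.weighted_tree_number_formula)
  moreover have "(\<Prod>j\<in>B.cells. ?w j) \<noteq> 0" using nz B.finite_J by (simp add: prod_zero_iff)
  moreover have "(\<Prod>j\<in>B.core. ?p j) \<noteq> 0"
    using pnz B.finite_core core by (simp only: prod_zero_iff) blast
  ultimately have "to_fract (weighted_tree_number (int d) \<Delta>) /
      to_fract (weighted_tree_number (int d) (\<Delta> - {\<sigma>})) = ?w l' * ?p l'" by simp
  also have "\<dots> = (\<Prod>q\<in>?C. vertex_fract q (l' q) * pivot (vertex_fract q) (l' q))"
    by (rule prod.distrib[symmetric])
  also have "\<dots> = (\<Prod>q = 1..d + 1. to_fract (D_sum q (l q)) / to_fract (D_sum q (l q - 1)))"
    by (intro prod.cong refl) (use nz l'q in \<open>simp add: pivot_def partial_sum_vertex_fract\<close>)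
  finally show ?thesis .
qed

end
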